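(* Let $([0,\tau],\le,+)$ be a truncated ordered abelian group (as defined in the context) possessing a least positive element, denoted $1$. Then $[0,\tau]$ (with $1$) is a Presburger truncated ordered abelian group if and only if both of the following hold: (1) $[0,\tau]$ is discretely ordered and every positive element is a successor; (2) for each positive integer $n$ and each $x\in[0,\tau]$ there exist $y\in[0,\tau]$ and an integer $m$ with $0\le m<n$ such that $x=(y+\dots+y)+(1+\dots+1)$, with $n$ summands $y$ and $m$ summands $1$ (where for $m=0$ the second sum is $0$).
   Context: A truncated ordered abelian group (TOAG) is a linearly ordered set $([0,\tau],\le)$ with least element $0$ and greatest element $\tau$, together with a binary operation $+$ on $[0,\tau]$, satisfying the following Axioms 1–16 (variables over $[0,\tau]$, universally quantified). 1. $x+y=y+x$. 2. $x+0=x$. 3. $x+\tau=\tau$. 4. If $x_1\le y_1$ and $x_2\le y_2$ then $x_1+x_2\le y_1+y_2$. 5. $x+(y+z)=(x+y)+z$ (written $x+y+z$). 6. If $x+y=x+z<\tau$ then $y=z$. 7. If $x\le y<\tau$ there is a unique $z$ with $x+z=y$, denoted $y\dot{-}x$. 8. For each $x$ there is some $z$ with $x+z=\tau$, and among such $z$ there is a least one, denoted $\tau\dot{-}x$. 9. $\tau\dot{-}(\tau\dot{-}x)=x$. Convention: $A\dot{-}B$ is only written when $A\ge B$. 10. If $x,y<\tau$ and $x+y=\tau$, then $y\dot{-}(\tau\dot{-}x)=x\dot{-}(\tau\dot{-}y)$. 11. If $y+z<\tau$, $x+(y+z)=\tau$, $y+x<\tau$, then $x\dot{-}(\tau\dot{-}(y+z))=z\dot{-}(\tau\dot{-}(x+y))$.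 12. If $y+z<\tau$, $x+y+z=\tau$, $y+x=\tau$, $z+(y\dot{-}(\tau\dot{-}x))<\tau$, then $z+(y\dot{-}(\tau\dot{-}x))=x\dot{-}(\tau\dot{-}(y+z))$. 13. If $y+x=\tau$ and $y+z<\tau$, then $z+(y\dot{-}(\tau\dot{-}x))<\tau$. 14. If $y+z=y+x=\tau$ and $z+(y\dot{-}(\tau\dot{-}x))<\tau$, then $x+(y\dot{-}(\tau\dot{-}z))=(x\dot{-}(\tau\dot{-}y))+z$. 15. If $y+z=\tau$, $y+x=\tau$, $x+(y\dot{-}(\tau\dot{-}z))=\tau$, then $z+(y\dot{-}(\tau\dot{-}x))=\tau$. 16. If $y+z=y+x=x+(y\dot{-}(\tau\dot{-}z))=\tau$, then $(y\dot{-}(\tau\dot{-}x))\dot{-}(\tau\dot{-}z)=(y\dot{-}(\tau\dot{-}z))\dot{-}(\tau\dot{-}x)$. Presburger arithmetic is the first-order theory of $(\mathbb{Z},+,-,\le,0,1)$ in the language of ordered groups with a constant $1$ (denoting the least positive element). A Presburger truncated ordered abelian group is a TOAG $[0,\tau]$ with distinguished element $1$, its least positive element (it is not required that $1<\tau$), which is isomorphic (as ordered structure with $+$ and $1$) to a truncation $[0,\tau_M]=\{g\in M:0\le g\le\tau_M\}$ of a model $M$ of Presburger arithmetic, with $\tau_M\ge 0$ in $M$ and truncated addition $a+b=\min(a+_M b,\tau_M)$. *)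

theory Defs
  imports Main
begin

section \<open>Truncated ordered abelian groups\<close>

record 'a trunc =
  tcarrier :: "'a set"
  tle :: "'a \<Rightarrow> 'a \<Rightarrow> bool" (infix \<open>\<sqsubseteq>\<index>\<close> 50)
  tadd :: "'a \<Rightarrow> 'a \<Rightarrow> 'a" (infixl \<open>\<oplus>\<index>\<close> 65)
  tzero :: 'a (\<open>\<zero>\<index>\<close>)
  ttop :: 'a (\<open>\<tau>\<index>\<close>)

definition tless :: "'a trunc \<Rightarrow> 'a \<Rightarrow> 'a \<Rightarrow> bool" (infix \<open>\<sqsubset>\<index>\<close> 50)
  where "x \<sqsubset>\<^bsub>T\<^esub> y \<longleftrightarrow> x \<sqsubseteq>\<^bsub>T\<^esub> y \<and> x \<noteq> y"

text \<open>The difference y - x is only meaningful for x below y. If y is the greatest element it is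
  the least z with x + z = y, otherwise it is the unique such z.\<close>

definition tdiff :: "'a trunc \<Rightarrow> 'a \<Rightarrow> 'a \<Rightarrow> 'a" (infixl \<open>\<ominus>\<index>\<close> 65)
  where "y \<ominus>\<^bsub>T\<^esub> x =
    (if y = \<tau>\<^bsub>T\<^esub>
     then (THE z. z \<in> tcarrier T \<and> x \<oplus>\<^bsub>T\<^esub> z = \<tau>\<^bsub>T\<^esub> \<and>
                  (\<forall>w\<in>tcarrier T. x \<oplus>\<^bsub>T\<^esub> w = \<tau>\<^bsub>T\<^esub> \<longrightarrow> z \<sqsubseteq>\<^bsub>T\<^esub> w))
     else (THE z. z \<in> tcarrier T \<and> x \<oplus>\<^bsub>T\<^esub> z = y))"

text \<open>In \<open>ax10\<close> to \<open>ax16\<close> the hypotheses, together with the preceding axioms, ensure that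
  every difference that occurs is taken between comparable elements in the right order.\<close>

locale toag =
  fixes T :: "'a trunc" (structure)
  assumes le_refl: "reflp_on (tcarrier T) (\<sqsubseteq>)"
    and le_trans: "transp_on (tcarrier T) (\<sqsubseteq>)"
    and le_antisym: "antisymp_on (tcarrier T) (\<sqsubseteq>)"
    and le_total: "totalp_on (tcarrier T) (\<sqsubseteq>)"
    and zero_closed: "\<zero> \<in> tcarrier T"
    and top_closed: "\<tau> \<in> tcarrier T"
    and zero_least: "x \<in> tcarrier T \<Longrightarrow> \<zero> \<sqsubseteq> x"
    and top_greatest: "x \<in> tcarrier T \<Longrightarrow> x \<sqsubseteq> \<tau>"
    and add_closed: "\<lbrakk>x \<in> tcarrier T; y \<in> tcarrier T\<rbrakk> \<Longrightarrow> x \<oplus> y \<in> tcarrier T"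
    and ax1: "\<lbrakk>x \<in> tcarrier T; y \<in> tcarrier T\<rbrakk> \<Longrightarrow> x \<oplus> y = y \<oplus> x"
    and ax2: "x \<in> tcarrier T \<Longrightarrow> x \<oplus> \<zero> = x"
    and ax3: "x \<in> tcarrier T \<Longrightarrow> x \<oplus> \<tau> = \<tau>"
    and ax4: "\<lbrakk>x1 \<in> tcarrier T; y1 \<in> tcarrier T; x2 \<in> tcarrier T; y2 \<in> tcarrier T;
               x1 \<sqsubseteq> y1; x2 \<sqsubseteq> y2\<rbrakk> \<Longrightarrow> x1 \<oplus> x2 \<sqsubseteq> y1 \<oplus> y2"
    and ax5: "\<lbrakk>x \<in> tcarrier T; y \<in> tcarrier T; z \<in> tcarrier T\<rbrakk>
               \<Longrightarrow> x \<oplus> (y \<oplus> z) = (x \<oplus> y) \<oplus> z"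
    and ax6: "\<lbrakk>x \<in> tcarrier T; y \<in> tcarrier T; z \<in> tcarrier T;
               x \<oplus> y = x \<oplus> z; x \<oplus> z \<sqsubset> \<tau>\<rbrakk> \<Longrightarrow> y = z"
    and ax7: "\<lbrakk>x \<in> tcarrier T; y \<in> tcarrier T; x \<sqsubseteq> y; y \<sqsubset> \<tau>\<rbrakk>
               \<Longrightarrow> \<exists>!z. z \<in> tcarrier T \<and> x \<oplus> z = y"
    and ax8: "x \<in> tcarrier T
               \<Longrightarrow> \<exists>z\<in>tcarrier T. x \<oplus> z = \<tau> \<and> (\<forall>w\<in>tcarrier T. x \<oplus> w = \<tau> \<longrightarrow> z \<sqsubseteq> w)"
    and ax9: "x \<in> tcarrier T \<Longrightarrow> \<tau> \<ominus> (\<tau> \<ominus> x) = x"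
    and ax10: "\<lbrakk>x \<in> tcarrier T; y \<in> tcarrier T; x \<sqsubset> \<tau>; y \<sqsubset> \<tau>; x \<oplus> y = \<tau>\<rbrakk>
               \<Longrightarrow> y \<ominus> (\<tau> \<ominus> x) = x \<ominus> (\<tau> \<ominus> y)"
    and ax11: "\<lbrakk>x \<in> tcarrier T; y \<in> tcarrier T; z \<in> tcarrier T;
                y \<oplus> z \<sqsubset> \<tau>; x \<oplus> (y \<oplus> z) = \<tau>; y \<oplus> x \<sqsubset> \<tau>\<rbrakk>
               \<Longrightarrow> x \<ominus> (\<tau> \<ominus> (y \<oplus> z)) = z \<ominus> (\<tau> \<ominus> (x \<oplus> y))"
    and ax12: "\<lbrakk>x \<in> tcarrier T; y \<in> tcarrier T; z \<in> tcarrier T;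
                y \<oplus> z \<sqsubset> \<tau>; x \<oplus> y \<oplus> z = \<tau>; y \<oplus> x = \<tau>; z \<oplus> (y \<ominus> (\<tau> \<ominus> x)) \<sqsubset> \<tau>\<rbrakk>
               \<Longrightarrow> z \<oplus> (y \<ominus> (\<tau> \<ominus> x)) = x \<ominus> (\<tau> \<ominus> (y \<oplus> z))"
    and ax13: "\<lbrakk>x \<in> tcarrier T; y \<in> tcarrier T; z \<in> tcarrier T;
                y \<oplus> x = \<tau>; y \<oplus> z \<sqsubset> \<tau>\<rbrakk>
               \<Longrightarrow> z \<oplus> (y \<ominus> (\<tau> \<ominus> x)) \<sqsubset> \<tau>"
    and ax14: "\<lbrakk>x \<in> tcarrier T; y \<in> tcarrier T; z \<in> tcarrier T;
                y \<oplus> z = \<tau>; y \<oplus> x = \<tau>; z \<oplus> (y \<ominus> (\<tau> \<ominus> x)) \<sqsubset> \<tau>\<rbrakk>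
               \<Longrightarrow> x \<oplus> (y \<ominus> (\<tau> \<ominus> z)) = (x \<ominus> (\<tau> \<ominus> y)) \<oplus> z"
    and ax15: "\<lbrakk>x \<in> tcarrier T; y \<in> tcarrier T; z \<in> tcarrier T;
                y \<oplus> z = \<tau>; y \<oplus> x = \<tau>; x \<oplus> (y \<ominus> (\<tau> \<ominus> z)) = \<tau>\<rbrakk>
               \<Longrightarrow> z \<oplus> (y \<ominus> (\<tau> \<ominus> x)) = \<tau>"
    and ax16: "\<lbrakk>x \<in> tcarrier T; y \<in> tcarrier T; z \<in> tcarrier T;
                y \<oplus> z = \<tau>; y \<oplus> x = \<tau>; x \<oplus> (y \<ominus> (\<tau> \<ominus> z)) = \<tau>\<rbrakk>
               \<Longrightarrow> (y \<ominus> (\<tau> \<ominus> x)) \<ominus> (\<tau> \<ominus> z) = (y \<ominus> (\<tau> \<ominus> z)) \<ominus> (\<tau> \<ominus> x)"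

definition least_positive :: "'a trunc \<Rightarrow> 'a \<Rightarrow> bool"
  where "least_positive T u \<longleftrightarrow> u \<in> tcarrier T \<and> \<zero>\<^bsub>T\<^esub> \<sqsubset>\<^bsub>T\<^esub> u \<and>
    (\<forall>x\<in>tcarrier T. \<zero>\<^bsub>T\<^esub> \<sqsubset>\<^bsub>T\<^esub> x \<longrightarrow> u \<sqsubseteq>\<^bsub>T\<^esub> x)"

text \<open>\<open>successor_of T y x\<close>: x is the immediate successor of y in the order.\<close>

definition successor_of :: "'a trunc \<Rightarrow> 'a \<Rightarrow> 'a \<Rightarrow> bool"
  where "successor_of T y x \<longleftrightarrow> y \<in> tcarrier T \<and> x \<in> tcarrier T \<and> y \<sqsubset>\<^bsub>T\<^esub> x \<and>
    \<not> (\<exists>z\<in>tcarrier T. y \<sqsubset>\<^bsub>T\<^esub> z \<and> z \<sqsubset>\<^bsub>T\<^esub> x)"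

text \<open>Discreteness of a linear order: every element that is not the greatest has an immediate
  successor, and every element that is not the least has an immediate predecessor.\<close>

definition discretely_ordered :: "'a trunc \<Rightarrow> bool"
  where "discretely_ordered T \<longleftrightarrow>
    (\<forall>x\<in>tcarrier T. (\<exists>y\<in>tcarrier T. x \<sqsubset>\<^bsub>T\<^esub> y) \<longrightarrow> (\<exists>y. successor_of T x y)) \<and>
    (\<forall>x\<in>tcarrier T. (\<exists>y\<in>tcarrier T. y \<sqsubset>\<^bsub>T\<^esub> x) \<longrightarrow> (\<exists>y. successor_of T y x))"

primrec tmult :: "'a trunc \<Rightarrow> nat \<Rightarrow> 'a \<Rightarrow> 'a"
  where
    "tmult T 0 y = \<zero>\<^bsub>T\<^esub>"
  | "tmult T (Suc k) y = tmult T k y \<oplus>\<^bsub>T\<^esub> y"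


section \<open>Presburger arithmetic\<close>

datatype pterm = PVar nat | PZero | POne | PAdd pterm pterm | PNeg pterm

datatype pform =
    PEq pterm pterm
  | PLe pterm pterm
  | PFalse
  | PImp pform pform
  | PAll nat pform

primrec term_vars :: "pterm \<Rightarrow> nat set"
  where
    "term_vars (PVar n) = {n}"
  | "term_vars PZero = {}"
  | "term_vars POne = {}"
  | "term_vars (PAdd s t) = term_vars s \<union> term_vars t"
  | "term_vars (PNeg t) = term_vars t"

primrec free_vars :: "pform \<Rightarrow> nat set"
  where
    "free_vars (PEq s t) = term_vars s \<union> term_vars t"
  | "free_vars (PLe s t) = term_vars s \<union> term_vars t"
  | "free_vars PFalse = {}"
  | "free_vars (PImp \<phi> \<psi>) = free_vars \<phi> \<union> free_vars \<psi>"
  | "free_vars (PAll n \<phi>) = free_vars \<phi> - {n}"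

definition sentence :: "pform \<Rightarrow> bool"
  where "sentence \<phi> \<longleftrightarrow> free_vars \<phi> = {}"

record 'm pstruct =
  pdom :: "'m set"
  padd :: "'m \<Rightarrow> 'm \<Rightarrow> 'm"
  pneg :: "'m \<Rightarrow> 'm"
  ple :: "'m \<Rightarrow> 'm \<Rightarrow> bool"
  pzero :: 'm
  pone :: 'm

definition is_structure :: "'m pstruct \<Rightarrow> bool"
  where "is_structure M \<longleftrightarrow> pzero M \<in> pdom M \<and> pone M \<in> pdom M \<and>
    (\<forall>a\<in>pdom M. \<forall>b\<in>pdom M. padd M a b \<in> pdom M) \<and> (\<forall>a\<in>pdom M. pneg M a \<in> pdom M)"

primrec term_val :: "'m pstruct \<Rightarrow> (nat \<Rightarrow> 'm) \<Rightarrow> pterm \<Rightarrow> 'm"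
  where
    "term_val M e (PVar n) = e n"
  | "term_val M e PZero = pzero M"
  | "term_val M e POne = pone M"
  | "term_val M e (PAdd s t) = padd M (term_val M e s) (term_val M e t)"
  | "term_val M e (PNeg t) = pneg M (term_val M e t)"

primrec sat :: "'m pstruct \<Rightarrow> (nat \<Rightarrow> 'm) \<Rightarrow> pform \<Rightarrow> bool"
  where
    "sat M e (PEq s t) \<longleftrightarrow> term_val M e s = term_val M e t"
  | "sat M e (PLe s t) \<longleftrightarrow> ple M (term_val M e s) (term_val M e t)"
  | "sat M e PFalse \<longleftrightarrow> False"
  | "sat M e (PImp \<phi> \<psi>) \<longleftrightarrow> (sat M e \<phi> \<longrightarrow> sat M e \<psi>)"
  | "sat M e (PAll n \<phi>) \<longleftrightarrow> (\<forall>a\<in>pdom M. sat M (e(n := a)) \<phi>)"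

definition models :: "'m pstruct \<Rightarrow> pform \<Rightarrow> bool"
  where "models M \<phi> \<longleftrightarrow> (\<forall>e. range e \<subseteq> pdom M \<longrightarrow> sat M e \<phi>)"

definition int_struct :: "int pstruct"
  where "int_struct = \<lparr>pdom = UNIV, padd = (+), pneg = uminus, ple = (\<le>), pzero = 0, pone = 1\<rparr>"

definition presburger_arithmetic :: "pform set"
  where "presburger_arithmetic = {\<phi>. sentence \<phi> \<and> models int_struct \<phi>}"

definition presburger_model :: "'m pstruct \<Rightarrow> bool"
  where "presburger_model M \<longleftrightarrow> is_structure M \<and> (\<forall>\<phi>\<in>presburger_arithmetic. models M \<phi>)"


section \<open>Presburger truncated ordered abelian groups\<close>

definition truncation :: "'m pstruct \<Rightarrow> 'm \<Rightarrow> 'm trunc"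
  where "truncation M t =
    \<lparr>tcarrier = {g \<in> pdom M. ple M (pzero M) g \<and> ple M g t},
     tle = ple M,
     tadd = (\<lambda>a b. if ple M (padd M a b) t then padd M a b else t),
     tzero = pzero M,
     ttop = t\<rparr>"

text \<open>Preservation of the least and greatest elements follows from that of the order.\<close>

definition trunc_iso :: "'a trunc \<Rightarrow> 'a \<Rightarrow> 'b trunc \<Rightarrow> 'b \<Rightarrow> ('a \<Rightarrow> 'b) \<Rightarrow> bool"
  where "trunc_iso S u T v f \<longleftrightarrow>
    bij_betw f (tcarrier S) (tcarrier T) \<and>
    (\<forall>x\<in>tcarrier S. \<forall>y\<in>tcarrier S. x \<sqsubseteq>\<^bsub>S\<^esub> y \<longleftrightarrow> f x \<sqsubseteq>\<^bsub>T\<^esub> f y) \<and>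
    (\<forall>x\<in>tcarrier S. \<forall>y\<in>tcarrier S. f (x \<oplus>\<^bsub>S\<^esub> y) = f x \<oplus>\<^bsub>T\<^esub> f y) \<and>
    f u = v"

text \<open>HOL cannot quantify over types inside a formula, so the type over which the carrier of the
  Presburger model ranges is an explicit parameter. By the downward Loewenheim-Skolem theorem a
  model over any type can be replaced by one over \<open>'a \<times> int\<close>, where \<open>'a\<close> is the type of the
  elements of T: an elementary substructure containing the truncation has at most that many
  elements.\<close>

definition presburger_toag :: "'m itself \<Rightarrow> 'a trunc \<Rightarrow> 'a \<Rightarrow> bool"
  where "presburger_toag (_ :: 'm itself) T u \<longleftrightarrow>
    toag T \<and> least_positive T u \<and>
    (\<exists>(M :: 'm pstruct) t f. presburger_model M \<and> t \<in> pdom M \<and> ple M (pzero M) t \<and>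
       trunc_iso T u (truncation M t) (pone M) f)"

end

theory Submission
  imports Defs
begin

text \<open>A truncated ordered abelian group unrolls to an ordered abelian group of pairs \<open>(x, k)\<close>, read as
  \<open>x + k\<tau>\<close> with \<open>x < \<tau>\<close>, where addition carries into the second component; Axioms 10 to 16 are what
  associativity needs. Division with remainder passes from the truncation to the unrolled group, since
  \<open>\<tau> = (\<tau> - 1) + 1\<close>, which makes it a discretely ordered group with Euclidean division by every
  positive integer. Any two such groups are elementarily equivalent by a back-and-forth argument:
  assignments that agree on the signs and residues of all linear forms with sufficiently small
  coefficients satisfy the same formulas of given complexity. Conversely, division with remainder and
  the few order properties needed to carry it over to a truncation are sentences true in the integers.
  Condition (1) holds in every truncated ordered abelian group with a least positive element.\<close>

section \<open>Discretely ordered abelian groups\<close>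

text \<open>A sum that equals \<tau> in the truncation records only that the true sum is at least
  \<tau>. Equations therefore lift to the group only below \<tau>, which is why \<tau> itself is
  divided through its predecessor. The case \<open>u = \<tau>\<close> is allowed: then 1 becomes the
  pair (0, 1) and the unrolling is a copy of the integers. The bound on coefficients is what makes
  the back-and-forth step possible. Finitely many forms cut the order at finitely many places, so a
  new element can be placed by looking at the greatest value below it, and a common multiple of
  finitely many moduli controls its residues. Matching one element uses forms with larger
  coefficients, so every quantifier costs a larger bound; for a fixed formula the total cost is
  known in advance. Division with remainder speaks about T alone. It thus links models over
  different types: a model over any type yields division, and division yields the unrolling over
  \<open>'a \<times> int\<close>.\<close>

notation padd (infixl \<open>\<boxplus>\<index>\<close> 65)
  and pneg (\<open>\<boxminus>\<index> _\<close> [81] 80)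
  and ple (infix \<open>\<preceq>\<index>\<close> 50)
  and pzero (\<open>\<^bold>0\<index>\<close>)
  and pone (\<open>\<^bold>1\<index>\<close>)

primrec nmul :: "'m pstruct \<Rightarrow> nat \<Rightarrow> 'm \<Rightarrow> 'm"
  where
    "nmul M 0 x = pzero M"
  | "nmul M (Suc n) x = padd M (nmul M n x) x"

definition zmul :: "'m pstruct \<Rightarrow> int \<Rightarrow> 'm \<Rightarrow> 'm" (infixr \<open>\<cdot>\<index>\<close> 75)
  where "zmul M k x = (if k \<ge> 0 then nmul M (nat k) x else pneg M (nmul M (nat (- k)) x))"

definition pos :: "'m pstruct \<Rightarrow> 'm \<Rightarrow> bool"
  where "pos M x \<longleftrightarrow> ple M (pzero M) x \<and> x \<noteq> pzero M"

text \<open>Stated through the sign of a difference, so that comparing two linear forms is asking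
  for the sign of a third one.\<close>

definition plt :: "'m pstruct \<Rightarrow> 'm \<Rightarrow> 'm \<Rightarrow> bool" (infix \<open>\<prec>\<index>\<close> 50)
  where "plt M x y \<longleftrightarrow> pos M (padd M y (pneg M x))"

definition ndvd :: "'m pstruct \<Rightarrow> int \<Rightarrow> 'm \<Rightarrow> bool"
  where "ndvd M n x \<longleftrightarrow> (\<exists>q\<in>pdom M. x = zmul M n q)"

primrec lin :: "'m pstruct \<Rightarrow> nat \<Rightarrow> (nat \<Rightarrow> int) \<Rightarrow> (nat \<Rightarrow> 'm) \<Rightarrow> 'm"
  where
    "lin M 0 c e = pzero M"
  | "lin M (Suc N) c e = padd M (lin M N c e) (zmul M (c N) (e N))"

text \<open>Division is kept out of this locale because the unrolling satisfies these laws before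
  anything is known about division in T.\<close>

locale discrete_pgroup =
  fixes M :: "'m pstruct" (structure)
  assumes is_struct: "is_structure M"
    and p_assoc: "\<lbrakk>x \<in> pdom M; y \<in> pdom M; z \<in> pdom M\<rbrakk> \<Longrightarrow> (x \<boxplus> y) \<boxplus> z = x \<boxplus> (y \<boxplus> z)"
    and p_comm: "\<lbrakk>x \<in> pdom M; y \<in> pdom M\<rbrakk> \<Longrightarrow> x \<boxplus> y = y \<boxplus> x"
    and p_zero: "x \<in> pdom M \<Longrightarrow> x \<boxplus> \<^bold>0 = x"
    and p_neg: "x \<in> pdom M \<Longrightarrow> x \<boxplus> \<boxminus> x = \<^bold>0"
    and ple_antisym: "\<lbrakk>x \<in> pdom M; y \<in> pdom M; x \<preceq> y; y \<preceq> x\<rbrakk> \<Longrightarrow> x = y"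
    and ple_trans: "\<lbrakk>x \<in> pdom M; y \<in> pdom M; z \<in> pdom M; x \<preceq> y; y \<preceq> z\<rbrakk> \<Longrightarrow> x \<preceq> z"
    and ple_total: "\<lbrakk>x \<in> pdom M; y \<in> pdom M\<rbrakk> \<Longrightarrow> x \<preceq> y \<or> y \<preceq> x"
    and ple_add: "\<lbrakk>x \<in> pdom M; y \<in> pdom M; z \<in> pdom M; x \<preceq> y\<rbrakk> \<Longrightarrow> x \<boxplus> z \<preceq> y \<boxplus> z"
    and one_pos: "pos M \<^bold>1"
    and one_least: "\<lbrakk>x \<in> pdom M; pos M x\<rbrakk> \<Longrightarrow> \<^bold>1 \<preceq> x"
begin

lemma zero_in [simp, intro]: "\<^bold>0 \<in> pdom M"
  and one_in [simp, intro]: "\<^bold>1 \<in> pdom M"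
  and add_in [simp, intro]: "\<lbrakk>x \<in> pdom M; y \<in> pdom M\<rbrakk> \<Longrightarrow> x \<boxplus> y \<in> pdom M"
  and neg_in [simp, intro]: "x \<in> pdom M \<Longrightarrow> \<boxminus> x \<in> pdom M"
  using is_struct unfolding is_structure_def by auto

lemma p_left_comm: "\<lbrakk>x \<in> pdom M; y \<in> pdom M; z \<in> pdom M\<rbrakk> \<Longrightarrow> x \<boxplus> (y \<boxplus> z) = y \<boxplus> (x \<boxplus> z)"
  by (metis p_assoc p_comm)

lemmas p_ac = p_assoc p_comm p_left_comm

lemma p_zero_left [simp]: "x \<in> pdom M \<Longrightarrow> \<^bold>0 \<boxplus> x = x"
  by (simp add: p_comm p_zero)

lemma p_neg_left: "x \<in> pdom M \<Longrightarrow> \<boxminus> x \<boxplus> x = \<^bold>0"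
  by (simp add: p_comm p_neg)

lemma p_cancel_neg [simp]:
  assumes "x \<in> pdom M" "y \<in> pdom M"
  shows "x \<boxplus> (\<boxminus> x \<boxplus> y) = y" "\<boxminus> x \<boxplus> (x \<boxplus> y) = y"
  using assms by (simp_all flip: p_assoc add: p_neg p_neg_left)

text \<open>AC rewriting may leave \<open>x\<close> and its inverse separated by another summand;
  the rule cancels across it.\<close>

lemma p_cancel_mid [simp]:
  assumes "x \<in> pdom M" "y \<in> pdom M" "z \<in> pdom M"
  shows "x \<boxplus> (y \<boxplus> (\<boxminus> x \<boxplus> z)) = y \<boxplus> z"
  using assms by (simp add: p_left_comm [of x y])

lemma p_cancel_mid' [simp]:
  assumes "x \<in> pdom M" "y \<in> pdom M"
  shows "x \<boxplus> (y \<boxplus> \<boxminus> x) = y"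
  using p_cancel_mid [of x y "\<^bold>0"] assms by (simp add: p_zero)

lemma p_left_cancel: "\<lbrakk>x \<in> pdom M; y \<in> pdom M; z \<in> pdom M\<rbrakk> \<Longrightarrow> x \<boxplus> y = x \<boxplus> z \<longleftrightarrow> y = z"
  by (metis p_cancel_neg(2))

lemma neg_unique: "\<lbrakk>x \<in> pdom M; y \<in> pdom M; x \<boxplus> y = \<^bold>0\<rbrakk> \<Longrightarrow> y = \<boxminus> x"
  by (metis p_left_cancel p_neg neg_in)

lemma neg_neg [simp]: "x \<in> pdom M \<Longrightarrow> \<boxminus> (\<boxminus> x) = x"
  by (metis neg_unique neg_in p_neg_left)

lemma neg_zero [simp]: "\<boxminus> \<^bold>0 = \<^bold>0"
  by (metis neg_unique p_zero zero_in)

lemma neg_add: "\<lbrakk>x \<in> pdom M; y \<in> pdom M\<rbrakk> \<Longrightarrow> \<boxminus> (x \<boxplus> y) = \<boxminus> x \<boxplus> \<boxminus> y"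
  by (rule neg_unique [symmetric]) (simp_all add: p_ac p_neg)

lemma diff_eq_zero: "\<lbrakk>x \<in> pdom M; y \<in> pdom M\<rbrakk> \<Longrightarrow> x \<boxplus> \<boxminus> y = \<^bold>0 \<longleftrightarrow> x = y"
  by (metis neg_unique neg_neg neg_in p_comm p_neg)

section \<open>Integer multiples\<close>

lemma nmul_in [simp, intro]: "x \<in> pdom M \<Longrightarrow> nmul M n x \<in> pdom M"
  by (induction n) auto

lemma zmul_in [simp, intro]: "x \<in> pdom M \<Longrightarrow> k \<cdot> x \<in> pdom M"
  by (simp add: zmul_def)

lemma zmul_0 [simp]: "0 \<cdot> x = \<^bold>0"
  by (simp add: zmul_def)

lemma zmul_1 [simp]: "x \<in> pdom M \<Longrightarrow> 1 \<cdot> x = x"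
  by (simp add: zmul_def)

lemma zmul_Suc:
  assumes "x \<in> pdom M"
  shows "(k + 1) \<cdot> x = k \<cdot> x \<boxplus> x"
proof (cases "k \<ge> 0")
  case True
  then show ?thesis by (simp add: zmul_def nat_add_distrib)
next
  case False
  then obtain n where n: "k = - int (Suc n)"
    by (metis int_cases linorder_not_less of_nat_0_le_iff)
  show ?thesis
    using assms by (auto simp: n zmul_def neg_add p_assoc p_neg_left p_zero nat_add_distrib)
qed

lemma zmul_pred:
  assumes "x \<in> pdom M"
  shows "(k - 1) \<cdot> x = k \<cdot> x \<boxplus> \<boxminus> x"
  using zmul_Suc [OF assms, of "k - 1"] assms by (simp add: p_assoc p_neg p_zero)

lemma zmul_add: "x \<in> pdom M \<Longrightarrow> (k + l) \<cdot> x = k \<cdot> x \<boxplus> l \<cdot> x"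
proof (induction l rule: int_induct [where k = 0])
  case base
  then show ?case by (simp add: p_zero)
next
  case (step1 i)
  then show ?case
    using zmul_Suc [of x "k + i"] by (simp add: zmul_Suc p_ac add.assoc)
next
  case (step2 i)
  then show ?case
    using zmul_pred [of x "k + i"] by (simp add: zmul_pred p_ac diff_add_eq add_diff_eq)
qed

lemma zmul_neg: "x \<in> pdom M \<Longrightarrow> (- k) \<cdot> x = \<boxminus> (k \<cdot> x)"
  using zmul_add [of x k "- k"] by (simp add: neg_unique)

lemma zmul_distrib:
  assumes "x \<in> pdom M" "y \<in> pdom M"
  shows "k \<cdot> (x \<boxplus> y) = k \<cdot> x \<boxplus> k \<cdot> y"
proof (induction k rule: int_induct [where k = 0])
  case base
  then show ?case by simp
next
  case (step1 i)
  then show ?case using assms by (simp add: zmul_Suc p_ac)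
next
  case (step2 i)
  then show ?case using assms by (simp add: zmul_pred neg_add p_ac)
qed

lemma zmul_mult:
  assumes "x \<in> pdom M"
  shows "(k * l) \<cdot> x = k \<cdot> l \<cdot> x"
proof (induction k rule: int_induct [where k = 0])
  case base
  then show ?case by simp
next
  case (step1 i)
  then show ?case using assms by (simp add: zmul_Suc zmul_add distrib_right)
next
  case (step2 i)
  then show ?case
    using assms zmul_add [of x "i * l" "- l"] by (simp add: zmul_pred zmul_neg left_diff_distrib)
qed

lemma zmul_zero [simp]: "k \<cdot> \<^bold>0 = \<^bold>0"
  using zmul_mult [of "\<^bold>0" k 0] by simp

lemma zmul_of_neg: "x \<in> pdom M \<Longrightarrow> k \<cdot> (\<boxminus> x) = \<boxminus> (k \<cdot> x)"
  using zmul_distrib [of x "\<boxminus> x" k] by (simp add: p_neg neg_unique)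

section \<open>Signs, order and discreteness\<close>

lemma pos_add: "\<lbrakk>x \<in> pdom M; y \<in> pdom M; pos M x; pos M y\<rbrakk> \<Longrightarrow> pos M (x \<boxplus> y)"
  using ple_add [of "\<^bold>0" x y] ple_trans [of "\<^bold>0" y "x \<boxplus> y"] ple_antisym [of "\<^bold>0" y]
  by (auto simp: pos_def)

lemma pos_neg:
  assumes "x \<in> pdom M"
  shows "pos M (\<boxminus> x) \<longleftrightarrow> \<not> pos M x \<and> x \<noteq> \<^bold>0"
proof -
  have "\<^bold>0 \<preceq> \<boxminus> x \<longleftrightarrow> x \<preceq> \<^bold>0"
    using ple_add [of "\<^bold>0" "\<boxminus> x" x] ple_add [of x "\<^bold>0" "\<boxminus> x"] assms
    by (auto simp: p_neg p_neg_left)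
  moreover have "\<boxminus> x = \<^bold>0 \<longleftrightarrow> x = \<^bold>0"
    using assms by (metis neg_neg neg_zero)
  ultimately show ?thesis
    using ple_antisym [of x "\<^bold>0"] ple_total [of x "\<^bold>0"] assms by (auto simp: pos_def)
qed

lemma not_pos_zero [simp]: "\<not> pos M \<^bold>0"
  by (simp add: pos_def)

lemma ple_iff: "\<lbrakk>x \<in> pdom M; y \<in> pdom M\<rbrakk> \<Longrightarrow> x \<preceq> y \<longleftrightarrow> \<not> pos M (x \<boxplus> \<boxminus> y)"
  using ple_add [of x y "\<boxminus> y"] ple_add [of y x "\<boxminus> y"] ple_total [of x y]
    ple_antisym [of "x \<boxplus> \<boxminus> y" "\<^bold>0"] ple_add [of "\<^bold>0" "x \<boxplus> \<boxminus> y" y] diff_eq_zero [of x y]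
  by (auto simp: pos_def p_neg p_ac p_neg_left p_zero)

lemma plt_zero: "x \<in> pdom M \<Longrightarrow> \<^bold>0 \<prec> x \<longleftrightarrow> pos M x"
  by (simp add: plt_def p_zero)

lemma plt_trans:
  assumes "x \<in> pdom M" "y \<in> pdom M" "z \<in> pdom M" "x \<prec> y" "y \<prec> z"
  shows "x \<prec> z"
  using pos_add [of "z \<boxplus> \<boxminus> y" "y \<boxplus> \<boxminus> x"] assms by (simp add: plt_def p_assoc)

lemma plt_linear: "\<lbrakk>x \<in> pdom M; y \<in> pdom M\<rbrakk> \<Longrightarrow> x \<prec> y \<or> x = y \<or> y \<prec> x"
  using pos_neg [of "x \<boxplus> \<boxminus> y"] diff_eq_zero [of x y] by (auto simp: plt_def neg_add p_ac)

lemma plt_irrefl [simp]: "x \<in> pdom M \<Longrightarrow> \<not> x \<prec> x"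
  by (simp add: plt_def p_neg)

lemma nplt_plt_trans: "\<lbrakk>x \<in> pdom M; y \<in> pdom M; z \<in> pdom M; \<not> y \<prec> x; y \<prec> z\<rbrakk> \<Longrightarrow> x \<prec> z"
  by (metis plt_trans plt_linear)

lemma plt_nplt_trans: "\<lbrakk>x \<in> pdom M; y \<in> pdom M; z \<in> pdom M; x \<prec> y; \<not> z \<prec> y\<rbrakk> \<Longrightarrow> x \<prec> z"
  by (metis plt_trans plt_linear)

lemma pos_nmul: "\<lbrakk>x \<in> pdom M; pos M x\<rbrakk> \<Longrightarrow> pos M (nmul M (Suc n) x)"
  by (induction n) (auto intro: pos_add)

lemma zmul_pos: "\<lbrakk>x \<in> pdom M; pos M x; k > 0\<rbrakk> \<Longrightarrow> pos M (k \<cdot> x)"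
  using pos_nmul [of x "nat k - 1"] by (simp add: zmul_def Suc_nat_eq_nat_zadd1)

lemma pos_zmul:
  assumes "x \<in> pdom M" "k > 0"
  shows "pos M (k \<cdot> x) \<longleftrightarrow> pos M x"
  using zmul_pos [OF assms(1)] zmul_pos [of "\<boxminus> x" k] pos_neg [of x] pos_neg [of "k \<cdot> x"] assms
  by (auto simp: zmul_of_neg)

text \<open>Nothing lies strictly between 0 and 1. The gain is that the negation of a strict
  inequality is again a strict inequality.\<close>

lemma pos_one_diff:
  assumes "x \<in> pdom M"
  shows "pos M (\<^bold>1 \<boxplus> \<boxminus> x) \<longleftrightarrow> \<not> pos M x"
proof
  assume "pos M (\<^bold>1 \<boxplus> \<boxminus> x)"
  then show "\<not> pos M x"
    using one_least [of x] assms by (auto simp: ple_iff)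
next
  assume "\<not> pos M x"
  then have "pos M (\<boxminus> x) \<or> x = \<^bold>0"
    using pos_neg assms by blast
  then show "pos M (\<^bold>1 \<boxplus> \<boxminus> x)"
    using pos_add [of "\<^bold>1" "\<boxminus> x"] one_pos assms by (auto simp: p_zero)
qed

lemma pos_one_zmul: "pos M (k \<cdot> \<^bold>1) \<longleftrightarrow> k > 0"
  using zmul_pos [of "\<^bold>1" k] zmul_pos [of "\<^bold>1" "- k"] pos_neg [of "k \<cdot> \<^bold>1"] one_pos
  by (cases k "0::int" rule: linorder_cases) (auto simp: zmul_neg)

text \<open>Induction on \<open>K\<close>: an element above \<open>i\<close> differs from it by at
  least 1, so it is \<open>i + 1\<close> or lies above \<open>i + 1\<close>.\<close>

lemma pos_cases:
  assumes "x \<in> pdom M" "pos M x" "K \<ge> 0"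
  obtains k where "k \<in> {1..K}" "x = k \<cdot> \<^bold>1" | "K \<cdot> \<^bold>1 \<prec> x"
proof -
  have "(\<exists>k\<in>{1..K}. x = k \<cdot> \<^bold>1) \<or> K \<cdot> \<^bold>1 \<prec> x"
    using \<open>K \<ge> 0\<close>
  proof (induction K rule: int_ge_induct)
    case base
    then show ?case using assms by (simp add: plt_zero)
  next
    case (step i)
    show ?case
    proof (cases "i \<cdot> \<^bold>1 \<prec> x")
      case True
      have "\<not> pos M (\<^bold>1 \<boxplus> \<boxminus> (x \<boxplus> \<boxminus> (i \<cdot> \<^bold>1)))"
        using pos_one_diff [of "x \<boxplus> \<boxminus> (i \<cdot> \<^bold>1)"] True assms by (simp add: plt_def)
      then have "\<not> x \<prec> (i + 1) \<cdot> \<^bold>1"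
        using assms by (simp add: plt_def zmul_Suc neg_add p_ac)
      then show ?thesis
        using plt_linear [of x "(i + 1) \<cdot> \<^bold>1"] assms step.hyps by auto
    next
      case False
      with step show ?thesis by force
    qed
  qed
  then show thesis using that by blast
qed

end

section \<open>Division with remainder and integer linear forms\<close>

locale zgroup = discrete_pgroup +
  assumes division: "\<lbrakk>n > 0; x \<in> pdom M\<rbrakk> \<Longrightarrow> \<exists>q\<in>pdom M. \<exists>k. x = n \<cdot> q \<boxplus> k \<cdot> \<^bold>1"
begin

text \<open>The axiom leaves \<open>k\<close> an arbitrary integer, so that the elements
  \<open>n q + k\<close> visibly form a subgroup. Reducing \<open>k\<close> modulo \<open>n\<close>
  and moving the quotient into \<open>q\<close> gives the usual remainder.\<close>

lemma ex_remainder: "n > 0 \<Longrightarrow> x \<in> pdom M \<Longrightarrow> \<exists>k. 0 \<le> k \<and> k < n \<and> ndvd M n (x \<boxplus> \<boxminus> (k \<cdot> \<^bold>1))"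
proof -
  assume n: "n > 0" and x: "x \<in> pdom M"
  obtain q k where q: "q \<in> pdom M" and k: "x = n \<cdot> q \<boxplus> k \<cdot> \<^bold>1"
    using division [OF n x] by blast
  have "k \<cdot> \<^bold>1 = n \<cdot> (k div n) \<cdot> \<^bold>1 \<boxplus> (k mod n) \<cdot> \<^bold>1"
    using zmul_add [of "\<^bold>1" "n * (k div n)" "k mod n"] by (simp add: zmul_mult)
  then have "x \<boxplus> \<boxminus> ((k mod n) \<cdot> \<^bold>1) = n \<cdot> (q \<boxplus> (k div n) \<cdot> \<^bold>1)"
    using q by (simp add: k zmul_distrib p_assoc p_neg p_zero)
  then show ?thesis
    using n q unfolding ndvd_def by (intro exI [of _ "k mod n"]) auto
qed

lemma ndvd_zmul_one:
  assumes "n > 0"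
  shows "ndvd M n (k \<cdot> \<^bold>1) \<longleftrightarrow> n dvd k"
proof
  assume "ndvd M n (k \<cdot> \<^bold>1)"
  then obtain q where q: "q \<in> pdom M" "k \<cdot> \<^bold>1 = n \<cdot> q"
    unfolding ndvd_def by auto
  \<comment> \<open>With the integer quotient of \<open>k\<close> by \<open>n\<close> subtracted,
    \<open>n s\<close> becomes \<open>k mod n\<close>; a nonzero remainder would put
    \<open>s\<close> strictly between 0 and 1.\<close>
  define s where "s = q \<boxplus> \<boxminus> ((k div n) \<cdot> \<^bold>1)"
  have s: "s \<in> pdom M"
    using q by (simp add: s_def)
  have "n \<cdot> s = k \<cdot> \<^bold>1 \<boxplus> (- (n * (k div n))) \<cdot> \<^bold>1"
    using q by (simp add: s_def zmul_distrib zmul_of_neg zmul_neg zmul_mult)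
  also have "\<dots> = (k mod n) \<cdot> \<^bold>1"
    using zmul_add [of "\<^bold>1" k "- (n * (k div n))"] by (simp add: minus_mult_div_eq_mod)
  finally have ns: "n \<cdot> s = (k mod n) \<cdot> \<^bold>1" .
  show "n dvd k"
  proof (rule ccontr)
    assume "\<not> n dvd k"
    then have "k mod n > 0"
      using assms by (simp add: dvd_eq_mod_eq_0 order_less_le)
    then have "pos M s"
      using pos_zmul [OF s assms] by (simp add: ns pos_one_zmul)
    then have "\<not> pos M (\<^bold>1 \<boxplus> \<boxminus> s)"
      using pos_one_diff s by blast
    then have "\<not> pos M (n \<cdot> (\<^bold>1 \<boxplus> \<boxminus> s))"
      using pos_zmul [OF _ assms] s by simp
    moreover have "n \<cdot> (\<^bold>1 \<boxplus> \<boxminus> s) = (n - k mod n) \<cdot> \<^bold>1"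
      using s zmul_add [of "\<^bold>1" n "- (k mod n)"] by (simp add: zmul_distrib zmul_of_neg ns zmul_neg)
    ultimately show False
      using assms by (simp add: pos_one_zmul)
  qed
next
  assume "n dvd k"
  then show "ndvd M n (k \<cdot> \<^bold>1)"
    unfolding ndvd_def dvd_def by (metis one_in zmul_in zmul_mult)
qed

lemma lin_in [simp, intro]: "range e \<subseteq> pdom M \<Longrightarrow> lin M N c e \<in> pdom M"
  by (induction N) (auto intro!: add_in zmul_in)

lemma in_range: "range e \<subseteq> pdom M \<Longrightarrow> e i \<in> pdom M"
  by auto

lemma lin_add: "range e \<subseteq> pdom M \<Longrightarrow> lin M N (\<lambda>i. c i + d i) e = lin M N c e \<boxplus> lin M N d e"
  by (induction N) (simp_all add: in_range zmul_add p_ac)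

lemma lin_mult: "range e \<subseteq> pdom M \<Longrightarrow> lin M N (\<lambda>i. k * c i) e = k \<cdot> lin M N c e"
  by (induction N) (simp_all add: in_range zmul_mult zmul_distrib)

lemma lin_neg: "range e \<subseteq> pdom M \<Longrightarrow> lin M N (\<lambda>i. - c i) e = \<boxminus> (lin M N c e)"
  using lin_mult [of e N "-1" c] by (simp add: zmul_neg)

lemma lin_diff: "range e \<subseteq> pdom M \<Longrightarrow> lin M N (\<lambda>i. c i - d i) e = lin M N c e \<boxplus> \<boxminus> (lin M N d e)"
  using lin_add [of e N c "\<lambda>i. - d i"] by (simp add: lin_neg)

lemma lin_cong: "\<lbrakk>\<And>i. i < N \<Longrightarrow> c i = d i; \<And>i. i < N \<Longrightarrow> c i \<noteq> 0 \<Longrightarrow> e i = f i\<rbrakk> \<Longrightarrow> lin M N c e = lin M N d f"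
proof (induction N)
  case (Suc N)
  then show ?case by (cases "c N = 0") auto
qed simp

lemma lin_zero: "lin M N (\<lambda>i. 0) e = \<^bold>0"
  by (induction N) (simp_all add: p_zero)

lemma lin_single:
  "\<lbrakk>range e \<subseteq> pdom M; j < N\<rbrakk> \<Longrightarrow> lin M N (\<lambda>i. if i = j then k else 0) e = k \<cdot> e j"
proof (induction N)
  case (Suc N)
  show ?case
  proof (cases "j = N")
    case True
    have "lin M N (\<lambda>i. if i = j then k else 0) e = lin M N (\<lambda>i. 0) e"
      by (rule lin_cong) (use True in auto)
    with Suc True show ?thesis by (simp add: lin_zero in_range)
  next
    case False
    with Suc show ?thesis by (simp add: p_zero in_range)
  qed
qed simp

lemma lin_upd:
  assumes "range e \<subseteq> pdom M" "a \<in> pdom M" "j < N"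
  shows "lin M N c (e(j := a)) = c j \<cdot> a \<boxplus> lin M N (c(j := 0)) e"
proof -
  have r: "range (e(j := a)) \<subseteq> pdom M"
    using assms by auto
  have "lin M N c (e(j := a)) =
      lin M N (\<lambda>i. (if i = j then c j else 0) + (c(j := 0)) i) (e(j := a))"
    by (rule lin_cong) auto
  also have "\<dots> = c j \<cdot> a \<boxplus> lin M N (c(j := 0)) (e(j := a))"
    using lin_add [OF r] lin_single [OF r \<open>j < N\<close>] by (simp add: fun_upd_def)
  also have "lin M N (c(j := 0)) (e(j := a)) = lin M N (c(j := 0)) e"
    by (rule lin_cong) auto
  finally show ?thesis .
qed

lemma ndvd_add:
  assumes "x \<in> pdom M" "y \<in> pdom M" "ndvd M n y"
  shows "ndvd M n (x \<boxplus> y) \<longleftrightarrow> ndvd M n x"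
proof -
  obtain q where q: "q \<in> pdom M" "y = n \<cdot> q"
    using assms unfolding ndvd_def by auto
  show ?thesis
  proof
    assume "ndvd M n (x \<boxplus> y)"
    then obtain q' where q': "q' \<in> pdom M" "x \<boxplus> y = n \<cdot> q'"
      unfolding ndvd_def by auto
    have "(x \<boxplus> y) \<boxplus> \<boxminus> y = x"
      using assms by (simp add: p_assoc p_neg p_zero)
    then have "x = n \<cdot> q' \<boxplus> \<boxminus> (n \<cdot> q)"
      by (simp only: q'(2) flip: q(2))
    also have "\<dots> = n \<cdot> (q' \<boxplus> \<boxminus> q)"
      using q(1) q'(1) by (simp add: zmul_distrib zmul_of_neg)
    finally show "ndvd M n x"
      using q(1) q'(1) unfolding ndvd_def by blast
  next
    assume "ndvd M n x"
    then obtain q' where q': "q' \<in> pdom M" "x = n \<cdot> q'"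
      unfolding ndvd_def by auto
    then have "x \<boxplus> y = n \<cdot> (q' \<boxplus> q)"
      using q(1) q'(1) by (simp add: q(2) zmul_distrib)
    then show "ndvd M n (x \<boxplus> y)"
      using q(1) q'(1) unfolding ndvd_def by blast
  qed
qed

lemma ndvd_zmul:
  assumes "x \<in> pdom M" "ndvd M n x"
  shows "ndvd M n (k \<cdot> x)"
  using assms unfolding ndvd_def by (metis zmul_in zmul_mult mult.commute)

lemma ndvd_dvd:
  assumes "ndvd M L x" "n dvd L"
  shows "ndvd M n x"
  using assms unfolding ndvd_def dvd_def by (metis zmul_in zmul_mult)

lemma lin_constant:
  assumes "x \<in> pdom M"
  shows "lin M (Suc p) c (\<lambda>i. if i = p then x else \<^bold>0) = c p \<cdot> x"
proof -
  have "lin M n c (\<lambda>i. if i = p then x else \<^bold>0) = \<^bold>0" if "n \<le> p" for n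
    using that by (induction n) (simp_all add: p_zero)
  then show ?thesis
    using assms by simp
qed

lemma lin_add_one:
  assumes "range e \<subseteq> pdom M" "p < N" "e p = \<^bold>1"
  shows "lin M N (\<lambda>i. c i + (if i = p then k else 0)) e = lin M N c e \<boxplus> k \<cdot> \<^bold>1"
  using assms by (simp add: lin_add lin_single)

text \<open>Lets a form with a negative coefficient be traded for one with a positive coefficient,
  at the price of 1 in slot \<open>p\<close>.\<close>

lemma pos_lin_one_minus:
  assumes "range e \<subseteq> pdom M" "p < N" "e p = \<^bold>1"
  shows "pos M (lin M N (\<lambda>i. - c i + (if i = p then 1 else 0)) e) \<longleftrightarrow> \<not> pos M (lin M N c e)"
  unfolding lin_add_one [OF assms] lin_neg [OF assms(1)]
  using assms pos_one_diff [of "lin M N c e"] by (simp add: p_comm)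

lemma lin_plt_lin:
  assumes "range e \<subseteq> pdom M" "p < N" "e p = \<^bold>1"
  shows "lin M N c e \<prec> lin M N d e \<boxplus> k \<cdot> \<^bold>1 \<longleftrightarrow>
    pos M (lin M N (\<lambda>i. (d i - c i) + (if i = p then k else 0)) e)"
  using assms by (simp add: lin_add_one lin_diff plt_def p_ac)

text \<open>Scaling by \<open>m\<close> brings the coefficient of the new element to the common
  value \<open>L\<close>, so only the position of \<open>L a\<close> among forms in the old values
  matters.\<close>

lemma pos_lin_upd:
  assumes "range e \<subseteq> pdom M" "a \<in> pdom M" "j < N" "c j * m = L" "m > 0"
  shows "pos M (lin M N c (e(j := a))) \<longleftrightarrow> lin M N (\<lambda>i. - m * (c(j := 0)) i) e \<prec> L \<cdot> a"
proof -
  have "L \<cdot> a \<boxplus> \<boxminus> (lin M N (\<lambda>i. - m * (c(j := 0)) i) e) = m \<cdot> lin M N c (e(j := a))"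
    unfolding lin_mult [OF assms(1)] \<open>c j * m = L\<close> [symmetric] lin_upd [OF assms(1-3)]
    using assms by (simp add: zmul_distrib zmul_neg mult.commute fun_upd_def flip: zmul_mult)
  moreover have "lin M N c (e(j := a)) \<in> pdom M"
    using assms by (intro lin_in) auto
  ultimately show ?thesis
    using assms pos_zmul [of "lin M N c (e(j := a))" m] by (simp add: plt_def)
qed

text \<open>Modulo \<open>n\<close> the new element may be replaced by the constant
  \<open>r\<close>, which joins the coefficient of slot \<open>p\<close>.\<close>

lemma ndvd_lin_upd:
  assumes "range e \<subseteq> pdom M" "a \<in> pdom M" "j < N" "p < N" "e p = \<^bold>1"
    and "ndvd M n (a \<boxplus> \<boxminus> (r \<cdot> \<^bold>1))"
  shows "ndvd M n (lin M N c (e(j := a))) \<longleftrightarrow>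
    ndvd M n (lin M N (\<lambda>i. (c(j := 0)) i + (if i = p then c j * r else 0)) e)"
proof -
  have "lin M N c (e(j := a)) =
      lin M N (\<lambda>i. (c(j := 0)) i + (if i = p then c j * r else 0)) e \<boxplus> c j \<cdot> (a \<boxplus> \<boxminus> (r \<cdot> \<^bold>1))"
    unfolding lin_add_one [OF assms(1,4,5)] lin_upd [OF assms(1-3)]
    using assms(1,2) by (simp add: zmul_distrib zmul_of_neg zmul_mult p_ac fun_upd_def)
  then show ?thesis
    using assms by (simp only:) (rule ndvd_add, auto intro!: lin_in ndvd_zmul)
qed

lemma add_plt_iff:
  assumes "x \<in> pdom M" "y \<in> pdom M"
  shows "x \<boxplus> k \<cdot> \<^bold>1 \<prec> y \<longleftrightarrow> x \<prec> y \<boxplus> (- k) \<cdot> \<^bold>1"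
  using assms by (simp add: plt_def zmul_neg neg_add p_ac)

text \<open>If \<open>a\<close> runs through the class of \<open>r\<close> modulo \<open>L\<close>,
  then \<open>L a\<close> runs through the class of \<open>L r\<close> modulo \<open>L * L\<close>.
  Dividing \<open>x - L r\<close> by \<open>L * L\<close> finds the last such element at or below
  \<open>x\<close>.\<close>

lemma ex_residue:
  assumes "x \<in> pdom M" "L > 0"
  obtains a k where "a \<in> pdom M" "ndvd M L (a \<boxplus> \<boxminus> (r \<cdot> \<^bold>1))" "0 \<le> k" "k < L * L" "x = L \<cdot> a \<boxplus> k \<cdot> \<^bold>1"
proof -
  obtain k q where k: "0 \<le> k" "k < L * L" and q: "q \<in> pdom M"
    and eq: "(x \<boxplus> \<boxminus> ((L * r) \<cdot> \<^bold>1)) \<boxplus> \<boxminus> (k \<cdot> \<^bold>1) = (L * L) \<cdot> q"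
    using ex_remainder [of "L * L" "x \<boxplus> \<boxminus> ((L * r) \<cdot> \<^bold>1)"] assms unfolding ndvd_def by auto
  define a where "a = r \<cdot> \<^bold>1 \<boxplus> L \<cdot> q"
  have "x = (((x \<boxplus> \<boxminus> ((L * r) \<cdot> \<^bold>1)) \<boxplus> \<boxminus> (k \<cdot> \<^bold>1)) \<boxplus> (L * r) \<cdot> \<^bold>1) \<boxplus> k \<cdot> \<^bold>1"
    using assms by (simp add: p_ac p_neg p_zero)
  also have "\<dots> = L \<cdot> a \<boxplus> k \<cdot> \<^bold>1"
    unfolding eq a_def using q by (simp add: zmul_distrib zmul_mult p_ac)
  finally have "x = L \<cdot> a \<boxplus> k \<cdot> \<^bold>1" .
  moreover have "a \<boxplus> \<boxminus> (r \<cdot> \<^bold>1) = L \<cdot> q"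
    using q by (simp add: a_def p_ac p_neg p_zero)
  ultimately show thesis
    using that [of a k] k q unfolding ndvd_def by (auto simp: a_def)
qed

text \<open>Approaching \<open>x + L * L\<close> from below instead of \<open>x\<close> turns a gap
  \<open>k\<close> in \<open>{0..<L * L}\<close> into the gap \<open>L * L - k\<close> above
  \<open>x\<close>.\<close>

lemma ex_residue_above:
  assumes "x \<in> pdom M" "L > 0"
  obtains a k where "a \<in> pdom M" "ndvd M L (a \<boxplus> \<boxminus> (r \<cdot> \<^bold>1))" "1 \<le> k" "k \<le> L * L" "L \<cdot> a = x \<boxplus> k \<cdot> \<^bold>1"
proof -
  obtain a k where a: "a \<in> pdom M" "ndvd M L (a \<boxplus> \<boxminus> (r \<cdot> \<^bold>1))" and k: "0 \<le> k" "k < L * L"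
    and eq: "x \<boxplus> (L * L) \<cdot> \<^bold>1 = L \<cdot> a \<boxplus> k \<cdot> \<^bold>1"
    using ex_residue [of "x \<boxplus> (L * L) \<cdot> \<^bold>1" L r] assms by auto
  have "L \<cdot> a = (L \<cdot> a \<boxplus> k \<cdot> \<^bold>1) \<boxplus> (- k) \<cdot> \<^bold>1"
    using a by (simp add: p_assoc zmul_neg p_neg p_zero)
  also have "\<dots> = x \<boxplus> (L * L - k) \<cdot> \<^bold>1"
    using zmul_add [of "\<^bold>1" "L * L" "- k"] assms by (simp flip: eq add: p_assoc)
  finally show thesis
    using that [of a "L * L - k"] a k by simp
qed

text \<open>Different forms may take the same value, so being greatest is expressed as having no
  form of larger value.\<close>

lemma ex_lin_greatest:
  assumes "finite S" "S \<noteq> {}" "range e \<subseteq> pdom M"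
  obtains s where "s \<in> S" "\<And>t. t \<in> S \<Longrightarrow> \<not> lin M N s e \<prec> lin M N t e"
proof -
  have "\<exists>s\<in>S. \<forall>t\<in>S. t \<noteq> s \<longrightarrow> \<not> lin M N s e \<prec> lin M N t e"
    by (rule Finite_Set.bex_max_element [OF \<open>finite S\<close>])
      (use assms in \<open>auto intro!: asymp_onI transp_onI\<close>, (metis lin_in plt_irrefl plt_trans)+)
  then show thesis
    using that assms by (metis lin_in plt_irrefl)
qed

lemma ex_lin_least:
  assumes "finite S" "S \<noteq> {}" "range e \<subseteq> pdom M"
  obtains s where "s \<in> S" "\<And>t. t \<in> S \<Longrightarrow> \<not> lin M N t e \<prec> lin M N s e"
proof -
  have "\<exists>s\<in>S. \<forall>t\<in>S. t \<noteq> s \<longrightarrow> \<not> lin M N t e \<prec> lin M N s e"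
    by (rule Finite_Set.bex_min_element [OF \<open>finite S\<close>])
      (use assms in \<open>auto intro!: asymp_onI transp_onI\<close>, (metis lin_in plt_irrefl plt_trans)+)
  then show thesis
    using that assms by (metis lin_in plt_irrefl)
qed

end

section \<open>Elementary equivalence\<close>

text \<open>In the forms below one coordinate \<open>p\<close> of the assignment always holds 1, so that constants need no
  separate treatment. The assignments agree up to B if no form with coefficients bounded by B and no
  modulus up to B tells them apart.\<close>

definition agree :: "nat \<Rightarrow> int \<Rightarrow> 'g pstruct \<Rightarrow> 'h pstruct \<Rightarrow> (nat \<Rightarrow> 'g) \<Rightarrow> (nat \<Rightarrow> 'h) \<Rightarrow> bool"
  where "agree N B G H e e' \<longleftrightarrow> (\<forall>c. (\<forall>i<N. \<bar>c i\<bar> \<le> B) \<longrightarrow>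
    (pos G (lin G N c e) \<longleftrightarrow> pos H (lin H N c e')) \<and>
    (\<forall>n. 1 \<le> n \<and> n \<le> B \<longrightarrow> (ndvd G n (lin G N c e) \<longleftrightarrow> ndvd H n (lin H N c e'))))"

lemma agree_pos: "\<lbrakk>agree N B G H e e'; \<And>i. i < N \<Longrightarrow> \<bar>c i\<bar> \<le> B\<rbrakk> \<Longrightarrow>
    pos G (lin G N c e) \<longleftrightarrow> pos H (lin H N c e')"
  unfolding agree_def by blast

lemma agree_ndvd: "\<lbrakk>agree N B G H e e'; \<And>i. i < N \<Longrightarrow> \<bar>c i\<bar> \<le> B; 1 \<le> n; n \<le> B\<rbrakk> \<Longrightarrow>
    ndvd G n (lin G N c e) \<longleftrightarrow> ndvd H n (lin H N c e')"
  unfolding agree_def by blast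

lemma agree_mono: "\<lbrakk>agree N B G H e e'; B' \<le> B\<rbrakk> \<Longrightarrow> agree N B' G H e e'"
  unfolding agree_def by (meson order_trans)

lemma agree_sym: "agree N B G H e e' \<longleftrightarrow> agree N B H G e' e"
  unfolding agree_def by blast

lemma finite_bounded_forms: "finite {c :: nat \<Rightarrow> int. (\<forall>i<N. \<bar>c i\<bar> \<le> K) \<and> (\<forall>i\<ge>N. c i = 0)}"
proof (rule finite_subset)
  show "finite {c. \<forall>i. (i \<in> {..<N} \<longrightarrow> c i \<in> {- K..K}) \<and> (i \<notin> {..<N} \<longrightarrow> c i = (0::int))}"
    by (rule finite_set_of_finite_funs) auto
qed force

text \<open>The element \<open>a'\<close> has to reproduce the cut of \<open>L a\<close> among the values of the bounded forms and the
  residue of \<open>a\<close> modulo L. If \<open>L a\<close> exceeds the largest value s below it by a standard number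
  \<open>k \<le> L\<^sup>2\<close>, the residue condition becomes a divisibility of the form \<open>s + k - L r\<close> by \<open>L\<^sup>2\<close> and can be
  transferred; otherwise the gap above s contains all residues modulo \<open>L\<^sup>2\<close>.\<close>

lemma agree_position:
  assumes G: "zgroup G" and H: "zgroup H"
    and e: "range e \<subseteq> pdom G" "e p = pone G"
    and e': "range e' \<subseteq> pdom H" "e' p = pone H"
    and "p < N" "L > 0" "K \<ge> 0"
    and agree: "agree N (2 * K + 2 * L * L) G H e e'"
    and a: "a \<in> pdom G"
  obtains a' r where "a' \<in> pdom H" "0 \<le> r" "r < L"
    "ndvd G L (a \<boxplus>\<^bsub>G\<^esub> \<boxminus>\<^bsub>G\<^esub> (r \<cdot>\<^bsub>G\<^esub> \<^bold>1\<^bsub>G\<^esub>))" "ndvd H L (a' \<boxplus>\<^bsub>H\<^esub> \<boxminus>\<^bsub>H\<^esub> (r \<cdot>\<^bsub>H\<^esub> \<^bold>1\<^bsub>H\<^esub>))"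
    "\<And>c. (\<And>i. i < N \<Longrightarrow> \<bar>c i\<bar> \<le> K) \<Longrightarrow>
       lin G N c e \<prec>\<^bsub>G\<^esub> L \<cdot>\<^bsub>G\<^esub> a \<longleftrightarrow> lin H N c e' \<prec>\<^bsub>H\<^esub> L \<cdot>\<^bsub>H\<^esub> a'"
proof -
  interpret G: zgroup G by fact
  interpret H: zgroup H by fact
  \<comment> \<open>Coefficients from \<open>N\<close> on are fixed to 0 to make the set of forms
    finite.\<close>
  define S where "S = {c :: nat \<Rightarrow> int. (\<forall>i<N. \<bar>c i\<bar> \<le> K) \<and> (\<forall>i\<ge>N. c i = 0)}"
  have finS: "finite S"
    unfolding S_def by (rule finite_bounded_forms)
  have S0: "(\<lambda>i. 0) \<in> S"
    using \<open>K \<ge> 0\<close> by (simp add: S_def)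
  note in_G [simp] = G.lin_in [OF e(1)] and in_H [simp] = H.lin_in [OF e'(1)]
  note [simp] = a
  have LaG [simp]: "L \<cdot>\<^bsub>G\<^esub> a \<in> pdom G"
    by simp
  have LL: "L * L > 0"
    using \<open>L > 0\<close> by simp
  \<comment> \<open>Comparing two values up to a constant asks for the sign of
    \<open>t - s + k\<close>, whose coefficients are at most \<open>2 * K + L * L\<close>; hence the
    doubled \<open>K\<close> in the bound.\<close>
  have compare: "lin G N s e \<prec>\<^bsub>G\<^esub> lin G N t e \<boxplus>\<^bsub>G\<^esub> k \<cdot>\<^bsub>G\<^esub> \<^bold>1\<^bsub>G\<^esub> \<longleftrightarrow>
      lin H N s e' \<prec>\<^bsub>H\<^esub> lin H N t e' \<boxplus>\<^bsub>H\<^esub> k \<cdot>\<^bsub>H\<^esub> \<^bold>1\<^bsub>H\<^esub>"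
    if "s \<in> S" "t \<in> S" "\<bar>k\<bar> \<le> L * L" for s t k
    unfolding G.lin_plt_lin [OF e(1) \<open>p < N\<close> e(2)] H.lin_plt_lin [OF e'(1) \<open>p < N\<close> e'(2)]
  proof (rule agree_pos [OF agree])
    fix i assume "i < N"
    then have "\<bar>s i\<bar> \<le> K" "\<bar>t i\<bar> \<le> K"
      using that by (auto simp: S_def)
    then show "\<bar>t i - s i + (if i = p then k else 0)\<bar> \<le> 2 * K + 2 * L * L"
      using that LL by auto
  qed
  have compare0: "lin G N s e \<prec>\<^bsub>G\<^esub> lin G N t e \<longleftrightarrow> lin H N s e' \<prec>\<^bsub>H\<^esub> lin H N t e'"
    if "s \<in> S" "t \<in> S" for s t
    using compare [OF that, of 0] LL by (simp add: G.p_zero H.p_zero)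
  obtain r where r: "0 \<le> r" "r < L" and dvdG: "ndvd G L (a \<boxplus>\<^bsub>G\<^esub> \<boxminus>\<^bsub>G\<^esub> (r \<cdot>\<^bsub>G\<^esub> \<^bold>1\<^bsub>G\<^esub>))"
    using G.ex_remainder [OF \<open>L > 0\<close> a] by blast
  have rL: "L * r \<le> L * L" "0 \<le> L * r"
    using r \<open>L > 0\<close> by auto
  have "\<exists>a'\<in>pdom H. ndvd H L (a' \<boxplus>\<^bsub>H\<^esub> \<boxminus>\<^bsub>H\<^esub> (r \<cdot>\<^bsub>H\<^esub> \<^bold>1\<^bsub>H\<^esub>)) \<and>
      (\<forall>s\<in>S. lin G N s e \<prec>\<^bsub>G\<^esub> L \<cdot>\<^bsub>G\<^esub> a \<longleftrightarrow> lin H N s e' \<prec>\<^bsub>H\<^esub> L \<cdot>\<^bsub>H\<^esub> a')"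
  proof (cases "\<exists>s\<in>S. lin G N s e \<prec>\<^bsub>G\<^esub> L \<cdot>\<^bsub>G\<^esub> a")
    case True
    define S1 where "S1 = {s \<in> S. lin G N s e \<prec>\<^bsub>G\<^esub> L \<cdot>\<^bsub>G\<^esub> a}"
    obtain s where s: "s \<in> S1" and max: "\<And>t. t \<in> S1 \<Longrightarrow> \<not> lin G N s e \<prec>\<^bsub>G\<^esub> lin G N t e"
      using G.ex_lin_greatest [of S1 e] finS True e by (auto simp: S1_def)
    have sS: "s \<in> S"
      using s by (simp add: S1_def)
    have "pos G (L \<cdot>\<^bsub>G\<^esub> a \<boxplus>\<^bsub>G\<^esub> \<boxminus>\<^bsub>G\<^esub> (lin G N s e))"
      using s by (simp add: S1_def plt_def)
    then consider (near) k where "k \<in> {1..L * L}" "L \<cdot>\<^bsub>G\<^esub> a \<boxplus>\<^bsub>G\<^esub> \<boxminus>\<^bsub>G\<^esub> (lin G N s e) = k \<cdot>\<^bsub>G\<^esub> \<^bold>1\<^bsub>G\<^esub>"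
      | (far) "(L * L) \<cdot>\<^bsub>G\<^esub> \<^bold>1\<^bsub>G\<^esub> \<prec>\<^bsub>G\<^esub> L \<cdot>\<^bsub>G\<^esub> a \<boxplus>\<^bsub>G\<^esub> \<boxminus>\<^bsub>G\<^esub> (lin G N s e)"
      using G.pos_cases [of "L \<cdot>\<^bsub>G\<^esub> a \<boxplus>\<^bsub>G\<^esub> \<boxminus>\<^bsub>G\<^esub> (lin G N s e)" "L * L"] LL by auto
    then show ?thesis
    proof cases
      case near
      have "L \<cdot>\<^bsub>G\<^esub> a = lin G N s e \<boxplus>\<^bsub>G\<^esub> (L \<cdot>\<^bsub>G\<^esub> a \<boxplus>\<^bsub>G\<^esub> \<boxminus>\<^bsub>G\<^esub> (lin G N s e))"
        by (simp add: G.p_ac G.p_neg G.p_zero)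
      then have La: "L \<cdot>\<^bsub>G\<^esub> a = lin G N s e \<boxplus>\<^bsub>G\<^esub> k \<cdot>\<^bsub>G\<^esub> \<^bold>1\<^bsub>G\<^esub>"
        using near(2) by simp
      \<comment> \<open>The value of \<open>d\<close> is \<open>L (a - r)\<close>. Both
        \<open>k\<close> and \<open>L * r\<close> lie between 0 and \<open>L * L\<close>, so the
        constant added in slot \<open>p\<close> is at most \<open>L * L\<close> in absolute value
        and \<open>d\<close> stays within the bound.\<close>
      define d where "d = (\<lambda>i. s i + (if i = p then k - L * r else 0))"
      obtain q where q: "q \<in> pdom G" "a \<boxplus>\<^bsub>G\<^esub> \<boxminus>\<^bsub>G\<^esub> (r \<cdot>\<^bsub>G\<^esub> \<^bold>1\<^bsub>G\<^esub>) = L \<cdot>\<^bsub>G\<^esub> q"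
        using dvdG by (auto simp: ndvd_def)
      have "lin G N d e = L \<cdot>\<^bsub>G\<^esub> (a \<boxplus>\<^bsub>G\<^esub> \<boxminus>\<^bsub>G\<^esub> (r \<cdot>\<^bsub>G\<^esub> \<^bold>1\<^bsub>G\<^esub>))"
        using La G.zmul_add [of "\<^bold>1\<^bsub>G\<^esub>" k "- (L * r)"]
        by (simp add: d_def G.lin_add_one [OF e(1) \<open>p < N\<close> e(2)] G.zmul_distrib G.zmul_of_neg
            G.zmul_neg G.zmul_mult G.p_assoc)
      then have "ndvd G (L * L) (lin G N d e)"
        using q by (auto simp: ndvd_def G.zmul_mult)
      moreover have "ndvd G (L * L) (lin G N d e) \<longleftrightarrow> ndvd H (L * L) (lin H N d e')"
      proof (rule agree_ndvd [OF agree])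
        fix i assume "i < N"
        then have "\<bar>s i\<bar> \<le> K"
          using sS by (auto simp: S_def)
        then show "\<bar>d i\<bar> \<le> 2 * K + 2 * L * L"
          using near(1) rL by (auto simp: d_def)
      qed (use LL \<open>K \<ge> 0\<close> in auto)
      ultimately obtain q' where q': "q' \<in> pdom H" "lin H N d e' = (L * L) \<cdot>\<^bsub>H\<^esub> q'"
        by (auto simp: ndvd_def)
      \<comment> \<open>This choice makes \<open>L a'\<close> the value of \<open>s\<close> plus
        \<open>k\<close>, just as \<open>L a\<close> is in \<open>G\<close>; \<open>compare\<close>
        then settles all other forms.\<close>
      define a' where "a' = r \<cdot>\<^bsub>H\<^esub> \<^bold>1\<^bsub>H\<^esub> \<boxplus>\<^bsub>H\<^esub> L \<cdot>\<^bsub>H\<^esub> q'"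
      have a': "a' \<in> pdom H"
        using q' by (simp add: a'_def)
      have "L \<cdot>\<^bsub>H\<^esub> a' = lin H N d e' \<boxplus>\<^bsub>H\<^esub> (L * r) \<cdot>\<^bsub>H\<^esub> \<^bold>1\<^bsub>H\<^esub>"
        using q' by (simp add: a'_def H.zmul_distrib H.zmul_mult H.p_comm)
      also have "\<dots> = lin H N s e' \<boxplus>\<^bsub>H\<^esub> k \<cdot>\<^bsub>H\<^esub> \<^bold>1\<^bsub>H\<^esub>"
        using H.zmul_add [of "\<^bold>1\<^bsub>H\<^esub>" "k - L * r" "L * r"]
        by (simp add: d_def H.lin_add_one [OF e'(1) \<open>p < N\<close> e'(2)] H.p_assoc)
      finally have La': "L \<cdot>\<^bsub>H\<^esub> a' = lin H N s e' \<boxplus>\<^bsub>H\<^esub> k \<cdot>\<^bsub>H\<^esub> \<^bold>1\<^bsub>H\<^esub>" .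
      have "a' \<boxplus>\<^bsub>H\<^esub> \<boxminus>\<^bsub>H\<^esub> (r \<cdot>\<^bsub>H\<^esub> \<^bold>1\<^bsub>H\<^esub>) = L \<cdot>\<^bsub>H\<^esub> q'"
        using q' by (simp add: a'_def H.p_ac H.p_neg H.p_zero)
      then have "ndvd H L (a' \<boxplus>\<^bsub>H\<^esub> \<boxminus>\<^bsub>H\<^esub> (r \<cdot>\<^bsub>H\<^esub> \<^bold>1\<^bsub>H\<^esub>))"
        using q' by (auto simp: ndvd_def)
      then show ?thesis
        using a' compare [OF _ sS] near(1) unfolding La
        by (intro bexI [of _ a']) (auto simp: La')
    next
      case far
      then have far: "lin G N s e \<boxplus>\<^bsub>G\<^esub> (L * L) \<cdot>\<^bsub>G\<^esub> \<^bold>1\<^bsub>G\<^esub> \<prec>\<^bsub>G\<^esub> L \<cdot>\<^bsub>G\<^esub> a"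
        by (simp add: plt_def G.neg_add G.p_ac)
      obtain a' k where a': "a' \<in> pdom H" "ndvd H L (a' \<boxplus>\<^bsub>H\<^esub> \<boxminus>\<^bsub>H\<^esub> (r \<cdot>\<^bsub>H\<^esub> \<^bold>1\<^bsub>H\<^esub>))"
        and k: "1 \<le> k" "k \<le> L * L" and La': "L \<cdot>\<^bsub>H\<^esub> a' = lin H N s e' \<boxplus>\<^bsub>H\<^esub> k \<cdot>\<^bsub>H\<^esub> \<^bold>1\<^bsub>H\<^esub>"
        using H.ex_residue_above [of "lin H N s e'" L r] \<open>L > 0\<close> by auto
      have lower: "lin H N s e' \<prec>\<^bsub>H\<^esub> L \<cdot>\<^bsub>H\<^esub> a'"
        using k by (simp add: La' plt_def H.p_ac H.p_neg H.p_zero H.pos_one_zmul)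
      have "L \<cdot>\<^bsub>H\<^esub> a' \<boxplus>\<^bsub>H\<^esub> \<boxminus>\<^bsub>H\<^esub> (lin H N s e' \<boxplus>\<^bsub>H\<^esub> (L * L) \<cdot>\<^bsub>H\<^esub> \<^bold>1\<^bsub>H\<^esub>) = (k - L * L) \<cdot>\<^bsub>H\<^esub> \<^bold>1\<^bsub>H\<^esub>"
        using H.zmul_add [of "\<^bold>1\<^bsub>H\<^esub>" k "- (L * L)"]
        by (simp add: La' H.neg_add H.p_ac H.zmul_neg)
      then have upper: "\<not> lin H N s e' \<boxplus>\<^bsub>H\<^esub> (L * L) \<cdot>\<^bsub>H\<^esub> \<^bold>1\<^bsub>H\<^esub> \<prec>\<^bsub>H\<^esub> L \<cdot>\<^bsub>H\<^esub> a'"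
        using k by (simp add: plt_def H.pos_one_zmul)
      have "lin G N t e \<prec>\<^bsub>G\<^esub> L \<cdot>\<^bsub>G\<^esub> a \<longleftrightarrow> lin H N t e' \<prec>\<^bsub>H\<^esub> L \<cdot>\<^bsub>H\<^esub> a'" if t: "t \<in> S" for t
      proof (cases "lin G N t e \<prec>\<^bsub>G\<^esub> L \<cdot>\<^bsub>G\<^esub> a")
        case True
        then have "\<not> lin H N s e' \<prec>\<^bsub>H\<^esub> lin H N t e'"
          using max t sS compare0 by (auto simp: S1_def)
        then have "lin H N t e' \<prec>\<^bsub>H\<^esub> L \<cdot>\<^bsub>H\<^esub> a'"
          using H.nplt_plt_trans [OF _ _ _ _ lower] a' by simp
        with True show ?thesis by simp
      next
        case False
        \<comment> \<open>A form that is not below \<open>L a\<close> exceeds \<open>s\<close> by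
          more than \<open>L * L\<close>. This fact transfers to \<open>H\<close>, where
          \<open>L a'\<close> exceeds \<open>s\<close> by at most \<open>L * L\<close>.\<close>
        have "lin G N s e \<boxplus>\<^bsub>G\<^esub> (L * L) \<cdot>\<^bsub>G\<^esub> \<^bold>1\<^bsub>G\<^esub> \<prec>\<^bsub>G\<^esub> lin G N t e"
          using G.plt_nplt_trans [OF _ _ _ far False] by simp
        then have "lin H N s e' \<boxplus>\<^bsub>H\<^esub> (L * L) \<cdot>\<^bsub>H\<^esub> \<^bold>1\<^bsub>H\<^esub> \<prec>\<^bsub>H\<^esub> lin H N t e'"
          using compare [OF sS t, of "- (L * L)"] LL by (simp add: G.add_plt_iff H.add_plt_iff)
        then have "\<not> lin H N t e' \<prec>\<^bsub>H\<^esub> L \<cdot>\<^bsub>H\<^esub> a'"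
          using upper a' H.plt_trans [of "lin H N s e' \<boxplus>\<^bsub>H\<^esub> (L * L) \<cdot>\<^bsub>H\<^esub> \<^bold>1\<^bsub>H\<^esub>" "lin H N t e'"] by auto
        with False show ?thesis by simp
      qed
      then show ?thesis
        using a' by blast
    qed
  next
    case False
    \<comment> \<open>No bounded form has a value below \<open>L a\<close>, so it suffices to keep
      \<open>L a'\<close> at or below the least of all values, which \<open>ex_residue\<close>
      achieves.\<close>
    obtain s where s: "s \<in> S" and min: "\<And>t. t \<in> S \<Longrightarrow> \<not> lin G N t e \<prec>\<^bsub>G\<^esub> lin G N s e"
      using G.ex_lin_least [of S e] finS S0 e by blast
    obtain a' k where a': "a' \<in> pdom H" "ndvd H L (a' \<boxplus>\<^bsub>H\<^esub> \<boxminus>\<^bsub>H\<^esub> (r \<cdot>\<^bsub>H\<^esub> \<^bold>1\<^bsub>H\<^esub>))"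
      and k: "0 \<le> k" and eq: "lin H N s e' = L \<cdot>\<^bsub>H\<^esub> a' \<boxplus>\<^bsub>H\<^esub> k \<cdot>\<^bsub>H\<^esub> \<^bold>1\<^bsub>H\<^esub>"
      using H.ex_residue [OF in_H [of N s] \<open>L > 0\<close>, where r = r] by metis
    have "L \<cdot>\<^bsub>H\<^esub> a' \<boxplus>\<^bsub>H\<^esub> \<boxminus>\<^bsub>H\<^esub> (lin H N s e') = (- k) \<cdot>\<^bsub>H\<^esub> \<^bold>1\<^bsub>H\<^esub>"
      using a' by (simp add: eq H.neg_add H.p_ac H.zmul_neg)
    then have "\<not> lin H N s e' \<prec>\<^bsub>H\<^esub> L \<cdot>\<^bsub>H\<^esub> a'"
      using k by (simp add: plt_def H.pos_one_zmul)
    then have "\<not> lin H N t e' \<prec>\<^bsub>H\<^esub> L \<cdot>\<^bsub>H\<^esub> a'" if "t \<in> S" for t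
      using min [OF that] compare0 [OF that s] a' H.nplt_plt_trans
      by (metis H.zmul_in in_H)
    then show ?thesis
      using False a' by blast
  qed
  then obtain a' where a': "a' \<in> pdom H" "ndvd H L (a' \<boxplus>\<^bsub>H\<^esub> \<boxminus>\<^bsub>H\<^esub> (r \<cdot>\<^bsub>H\<^esub> \<^bold>1\<^bsub>H\<^esub>))"
    and pos: "\<And>s. s \<in> S \<Longrightarrow> lin G N s e \<prec>\<^bsub>G\<^esub> L \<cdot>\<^bsub>G\<^esub> a \<longleftrightarrow> lin H N s e' \<prec>\<^bsub>H\<^esub> L \<cdot>\<^bsub>H\<^esub> a'"
    by blast
  show thesis
  proof (rule that [OF a'(1) r dvdG a'(2)])
    fix c :: "nat \<Rightarrow> int" assume c: "\<And>i. i < N \<Longrightarrow> \<bar>c i\<bar> \<le> K"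
    \<comment> \<open>Coefficients from \<open>N\<close> on do not affect the value, so
      \<open>c\<close> can be cut off to lie in the finite set \<open>S\<close>.\<close>
    have "(\<lambda>i. if i < N then c i else 0) \<in> S"
      using c by (simp add: S_def)
    moreover have "lin G N (\<lambda>i. if i < N then c i else 0) e = lin G N c e"
      by (rule G.lin_cong) auto
    moreover have "lin H N (\<lambda>i. if i < N then c i else 0) e' = lin H N c e'"
      by (rule H.lin_cong) auto
    ultimately show "lin G N c e \<prec>\<^bsub>G\<^esub> L \<cdot>\<^bsub>G\<^esub> a \<longleftrightarrow> lin H N c e' \<prec>\<^bsub>H\<^esub> L \<cdot>\<^bsub>H\<^esub> a'"
      using pos by metis
  qed
qed

text \<open>With \<open>L = B!\<close>, a common multiple of all positive coefficients and moduli up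
  to \<open>B\<close>, this is the bound of \<open>agree_position\<close> for
  \<open>K = L (B + 1)\<close>. Scaling a form costs a factor of at most \<open>L\<close>, and
  \<open>B + 1\<close> leaves room for the 1 added when a form is negated.\<close>

definition extension_bound :: "int \<Rightarrow> int"
  where "extension_bound B = 2 * (fact (nat B) * (B + 1)) + 2 * fact (nat B) * fact (nat B)"

text \<open>Signs of forms in the new element are decided by the position of \<open>L a\<close>,
  divisibilities by the residue of \<open>a\<close> modulo \<open>L\<close>; one element
  \<open>a'\<close> reproduces both at once.\<close>

lemma agree_extend:
  assumes G: "zgroup G" and H: "zgroup H"
    and e: "range e \<subseteq> pdom G" "e p = pone G"
    and e': "range e' \<subseteq> pdom H" "e' p = pone H"
    and "p < N" "j < N" "j \<noteq> p" "B \<ge> 1"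
    and agree: "agree N (extension_bound B) G H e e'"
    and a: "a \<in> pdom G"
  shows "\<exists>a'\<in>pdom H. agree N B G H (e(j := a)) (e'(j := a'))"
proof -
  interpret G: zgroup G by fact
  interpret H: zgroup H by fact
  define L :: int where "L = fact (nat B)"
  have L: "L \<ge> 1"
    by (simp add: L_def)
  have dvd_L: "n dvd L" if "1 \<le> n" "n \<le> B" for n
  proof -
    have "nat n dvd fact (nat B)"
      using that by (intro dvd_fact) auto
    then have "int (nat n) dvd int (fact (nat B))"
      by (rule of_nat_dvd_iff [THEN iffD2])
    then show ?thesis
      using that by (simp add: L_def)
  qed
  have bound: "extension_bound B = 2 * (L * (B + 1)) + 2 * L * L"
    by (simp add: extension_bound_def L_def)
  have LB: "L * (B + 1) \<ge> B + 1" "L * B \<ge> B"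
    using mult_right_mono [OF L, of "B + 1"] mult_right_mono [OF L, of B] \<open>B \<ge> 1\<close> by auto
  have "2 * L * L \<ge> 0" "L * (B + 1) = L * B + L"
    by (simp_all add: algebra_simps)
  then have large: "B + L * B \<le> extension_bound B" "B \<le> extension_bound B"
    unfolding bound using LB L \<open>B \<ge> 1\<close> by linarith+
  obtain a' r where a': "a' \<in> pdom H" and r: "0 \<le> r" "r < L"
    and dvdG: "ndvd G L (a \<boxplus>\<^bsub>G\<^esub> \<boxminus>\<^bsub>G\<^esub> (r \<cdot>\<^bsub>G\<^esub> \<^bold>1\<^bsub>G\<^esub>))"
    and dvdH: "ndvd H L (a' \<boxplus>\<^bsub>H\<^esub> \<boxminus>\<^bsub>H\<^esub> (r \<cdot>\<^bsub>H\<^esub> \<^bold>1\<^bsub>H\<^esub>))"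
    and position: "\<And>c. (\<And>i. i < N \<Longrightarrow> \<bar>c i\<bar> \<le> L * (B + 1)) \<Longrightarrow>
       lin G N c e \<prec>\<^bsub>G\<^esub> L \<cdot>\<^bsub>G\<^esub> a \<longleftrightarrow> lin H N c e' \<prec>\<^bsub>H\<^esub> L \<cdot>\<^bsub>H\<^esub> a'"
    using agree_position [OF G H e e' \<open>p < N\<close> _ _ agree [unfolded bound] a] L \<open>B \<ge> 1\<close> by auto
  have positive: "pos G (lin G N c (e(j := a))) \<longleftrightarrow> pos H (lin H N c (e'(j := a')))"
    if c: "\<And>i. i < N \<Longrightarrow> \<bar>c i\<bar> \<le> B + 1" and cj: "0 < c j" "c j \<le> B" for c
  proof -
    obtain m where m: "c j * m = L"
      using dvd_L [of "c j"] cj by (auto simp: dvd_def)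
    then have "m > 0"
      using L cj by (metis zero_less_mult_pos less_le_trans zero_less_one)
    then have "m \<le> L"
      using m cj mult_right_mono [of 1 "c j" m] by auto
    show ?thesis
      unfolding G.pos_lin_upd [OF e(1) a \<open>j < N\<close>, of c m L, OF m \<open>m > 0\<close>] H.pos_lin_upd [OF e'(1) a' \<open>j < N\<close>, of c m L, OF m \<open>m > 0\<close>]
    proof (rule position)
      fix i assume "i < N"
      then have "\<bar>(c(j := 0)) i\<bar> \<le> B + 1"
        using c [of i] \<open>B \<ge> 1\<close> by auto
      then show "\<bar>- m * (c(j := 0)) i\<bar> \<le> L * (B + 1)"
        unfolding abs_mult using \<open>m > 0\<close> \<open>m \<le> L\<close> by (intro mult_mono) auto
    qed
  qed
  have ranges: "range (e(j := a)) \<subseteq> pdom G" "range (e'(j := a')) \<subseteq> pdom H"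
    using e e' a a' by auto
  have "pos G (lin G N c (e(j := a))) \<longleftrightarrow> pos H (lin H N c (e'(j := a')))"
    if c: "\<forall>i<N. \<bar>c i\<bar> \<le> B" for c
  proof (cases "c j" "0::int" rule: linorder_cases)
    case greater
    then show ?thesis
      using c \<open>j < N\<close> by (intro positive) force+
  next
    case equal
    have "lin G N c (e(j := a)) = lin G N c e" "lin H N c (e'(j := a')) = lin H N c e'"
      using equal by (auto intro: G.lin_cong H.lin_cong)
    then show ?thesis
      using agree_pos [OF agree, of c] c large by force
  next
    case less
    \<comment> \<open>A negative coefficient is made positive by passing from \<open>c\<close> to
      \<open>1 - c\<close>. Since \<open>j \<noteq> p\<close>, the added 1 leaves the coefficient of
      \<open>j\<close> alone.\<close>
    define d where "d = (\<lambda>i. - c i + (if i = p then 1 else 0))"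
    have "pos G (lin G N d (e(j := a))) \<longleftrightarrow> pos H (lin H N d (e'(j := a')))"
    proof (rule positive)
      show "\<bar>d i\<bar> \<le> B + 1" if "i < N" for i
        using c that by (fastforce simp: d_def)
      show "0 < d j" "d j \<le> B"
        using less c \<open>j < N\<close> \<open>j \<noteq> p\<close> by (fastforce simp: d_def)+
    qed
    then show ?thesis
      using G.pos_lin_one_minus [OF ranges(1) \<open>p < N\<close>, of c] H.pos_lin_one_minus [OF ranges(2) \<open>p < N\<close>, of c]
        e(2) e'(2) \<open>j \<noteq> p\<close> by (simp add: d_def)
  qed
  moreover have "ndvd G n (lin G N c (e(j := a))) \<longleftrightarrow> ndvd H n (lin H N c (e'(j := a')))"
    if c: "\<forall>i<N. \<bar>c i\<bar> \<le> B" and n: "1 \<le> n" "n \<le> B" for c n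
    unfolding G.ndvd_lin_upd [OF e(1) a \<open>j < N\<close> \<open>p < N\<close> e(2) G.ndvd_dvd [OF dvdG dvd_L [OF n]]]
      H.ndvd_lin_upd [OF e'(1) a' \<open>j < N\<close> \<open>p < N\<close> e'(2) H.ndvd_dvd [OF dvdH dvd_L [OF n]]]
  proof (rule agree_ndvd [OF agree])
    fix i assume "i < N"
    have "\<bar>c j * r\<bar> \<le> B * L"
      unfolding abs_mult using c \<open>j < N\<close> r by (intro mult_mono) auto
    moreover have "\<bar>(c(j := 0)) i\<bar> \<le> B"
      using c \<open>i < N\<close> \<open>B \<ge> 1\<close> by auto
    ultimately show "\<bar>(c(j := 0)) i + (if i = p then c j * r else 0)\<bar> \<le> extension_bound B"
      using large \<open>B \<ge> 1\<close> by (auto simp: mult.commute)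
  qed (use n large in auto)
  ultimately show ?thesis
    using a' unfolding agree_def by blast
qed

section \<open>Formulas as conditions on linear forms\<close>

primrec term_form :: "nat \<Rightarrow> pterm \<Rightarrow> nat \<Rightarrow> int"
  where
    "term_form p (PVar n) = (\<lambda>i. if i = n then 1 else 0)"
  | "term_form p PZero = (\<lambda>i. 0)"
  | "term_form p POne = (\<lambda>i. if i = p then 1 else 0)"
  | "term_form p (PAdd s t) = (\<lambda>i. term_form p s i + term_form p t i)"
  | "term_form p (PNeg t) = (\<lambda>i. - term_form p t i)"

lemma (in zgroup) term_val_eq_lin:
  assumes "range e \<subseteq> pdom M" "e p = \<^bold>1" "term_vars t \<subseteq> {..<p}"
  shows "term_val M e t = lin M (Suc p) (term_form p t) e"
  using assms(3)
proof (induction t)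
  case (PVar n)
  then show ?case
    using lin_single [OF assms(1), of n "Suc p" 1] assms(1) by (simp add: in_range del: lin.simps)
next
  case PZero
  show ?case using lin_zero by (simp del: lin.simps)
next
  case POne
  show ?case using lin_single [OF assms(1), of p "Suc p" 1] assms(2) by (simp del: lin.simps)
next
  case (PAdd s t)
  then show ?case by (simp add: lin_add [OF assms(1)] del: lin.simps)
next
  case (PNeg t)
  then show ?case by (simp add: lin_neg [OF assms(1)] del: lin.simps)
qed

text \<open>Bound variables are counted too: a quantifier over variable \<open>p\<close> would
  overwrite the 1 kept in that slot.\<close>

primrec vars_below :: "nat \<Rightarrow> pform \<Rightarrow> bool"
  where
    "vars_below p (PEq s t) \<longleftrightarrow> term_vars s \<union> term_vars t \<subseteq> {..<p}"
  | "vars_below p (PLe s t) \<longleftrightarrow> term_vars s \<union> term_vars t \<subseteq> {..<p}"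
  | "vars_below p PFalse \<longleftrightarrow> True"
  | "vars_below p (PImp \<phi> \<psi>) \<longleftrightarrow> vars_below p \<phi> \<and> vars_below p \<psi>"
  | "vars_below p (PAll n \<phi>) \<longleftrightarrow> n < p \<and> vars_below p \<phi>"

lemma vars_below_mono: "vars_below p \<phi> \<Longrightarrow> p \<le> q \<Longrightarrow> vars_below q \<phi>"
  by (induction \<phi>) auto

lemma finite_term_vars: "finite (term_vars t)"
  by (induction t) auto

lemma ex_vars_below: "\<exists>p. vars_below p \<phi>"
proof (induction \<phi>)
  case (PEq s t)
  show ?case
    using finite_nat_set_iff_bounded [of "term_vars s \<union> term_vars t"]
    by (auto simp: finite_term_vars subset_iff)
next
  case (PLe s t)
  show ?case
    using finite_nat_set_iff_bounded [of "term_vars s \<union> term_vars t"]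
    by (auto simp: finite_term_vars subset_iff)
next
  case (PImp \<phi> \<psi>)
  then obtain p q where "vars_below p \<phi>" "vars_below q \<psi>" by blast
  then have "vars_below (max p q) (PImp \<phi> \<psi>)"
    by (auto intro: vars_below_mono)
  then show ?case ..
next
  case (PAll n \<phi>)
  then obtain p where "vars_below p \<phi>" by blast
  then have "vars_below (max p (Suc n)) (PAll n \<phi>)"
    by (auto intro: vars_below_mono)
  then show ?case ..
qed simp

lemma ex_form_bound: "\<exists>B\<ge>1. \<forall>i<N. \<bar>(c :: nat \<Rightarrow> int) i\<bar> \<le> B"
proof (intro exI conjI allI impI)
  show "1 \<le> 1 + (\<Sum>i<N. \<bar>c i\<bar>)"
    by (simp add: sum_nonneg)
  fix i assume "i < N"
  then show "\<bar>c i\<bar> \<le> 1 + (\<Sum>i<N. \<bar>c i\<bar>)"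
    using member_le_sum [of i "{..<N}" "\<lambda>i. \<bar>c i\<bar>"] by simp
qed

text \<open>Induction on the formula, with \<open>extension_bound\<close> applied once per
  quantifier. The bound must not depend on the assignments, because in the quantifier case the
  induction hypothesis is used for all extensions at once.\<close>

lemma ex_sat_agree:
  assumes G: "zgroup G" and H: "zgroup H"
  shows "vars_below p \<phi> \<Longrightarrow> \<exists>B\<ge>1. \<forall>e e'. range e \<subseteq> pdom G \<and> e p = pone G \<and>
      range e' \<subseteq> pdom H \<and> e' p = pone H \<and> agree (Suc p) B G H e e' \<longrightarrow> sat G e \<phi> = sat H e' \<phi>"
proof (induction \<phi>)
  interpret G: zgroup G by fact
  interpret H: zgroup H by fact
  note forms = G.term_val_eq_lin [where p = p] H.term_val_eq_lin [where p = p]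
  {
    case (PLe s t)
    obtain B where B: "B \<ge> 1" "\<forall>i<Suc p. \<bar>term_form p s i - term_form p t i\<bar> \<le> B"
      using ex_form_bound [of "Suc p" "\<lambda>i. term_form p s i - term_form p t i"] by blast
    show ?case
    proof (intro exI conjI allI impI)
      show "B \<ge> 1" by fact
      fix e e' assume *: "range e \<subseteq> pdom G \<and> e p = pone G \<and> range e' \<subseteq> pdom H \<and> e' p = pone H \<and>
        agree (Suc p) B G H e e'"
      then show "sat G e (PLe s t) = sat H e' (PLe s t)"
        using agree_pos [of "Suc p" B G H e e' "\<lambda>i. term_form p s i - term_form p t i"] B(2) PLe
        by (simp add: forms G.ple_iff H.ple_iff G.lin_diff H.lin_diff G.lin_in H.lin_in
            del: lin.simps)
    qed
  next
    case (PEq s t)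
    obtain B where B: "B \<ge> 1" "\<forall>i<Suc p. \<bar>term_form p s i - term_form p t i\<bar> \<le> B"
      using ex_form_bound [of "Suc p" "\<lambda>i. term_form p s i - term_form p t i"] by blast
    show ?case
    proof (intro exI conjI allI impI)
      show "B \<ge> 1" by fact
      fix e e' assume *: "range e \<subseteq> pdom G \<and> e p = pone G \<and> range e' \<subseteq> pdom H \<and> e' p = pone H \<and>
        agree (Suc p) B G H e e'"
      \<comment> \<open>In a linear order equality is the failure of both strict comparisons, and
        each of them is the sign of a form.\<close>
      have "pos G (term_val G e s \<boxplus>\<^bsub>G\<^esub> \<boxminus>\<^bsub>G\<^esub> (term_val G e t)) \<longleftrightarrow>
          pos H (term_val H e' s \<boxplus>\<^bsub>H\<^esub> \<boxminus>\<^bsub>H\<^esub> (term_val H e' t))"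
        using agree_pos [of "Suc p" B G H e e' "\<lambda>i. term_form p s i - term_form p t i"] * B(2) PEq
        by (simp add: forms G.lin_diff H.lin_diff G.lin_in H.lin_in del: lin.simps)
      moreover have "pos G (term_val G e t \<boxplus>\<^bsub>G\<^esub> \<boxminus>\<^bsub>G\<^esub> (term_val G e s)) \<longleftrightarrow>
          pos H (term_val H e' t \<boxplus>\<^bsub>H\<^esub> \<boxminus>\<^bsub>H\<^esub> (term_val H e' s))"
        using agree_pos [of "Suc p" B G H e e' "\<lambda>i. term_form p t i - term_form p s i"] * B(2) PEq
        by (simp add: forms G.lin_diff H.lin_diff G.lin_in H.lin_in abs_minus_commute del: lin.simps)
      moreover have "term_val G e s \<in> pdom G" "term_val G e t \<in> pdom G"
        "term_val H e' s \<in> pdom H" "term_val H e' t \<in> pdom H"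
        using * PEq by (simp_all add: forms G.lin_in H.lin_in del: lin.simps)
      ultimately show "sat G e (PEq s t) = sat H e' (PEq s t)"
        using G.plt_linear [of "term_val G e s" "term_val G e t"]
          H.plt_linear [of "term_val H e' s" "term_val H e' t"]
        by (auto simp: plt_def G.p_neg H.p_neg)
    qed
  next
    case PFalse
    show ?case by (auto intro: exI [of _ 1])
  next
    case (PImp \<phi> \<psi>)
    obtain B1 where B1: "B1 \<ge> 1" "\<And>e e'. range e \<subseteq> pdom G \<and> e p = pone G \<and>
        range e' \<subseteq> pdom H \<and> e' p = pone H \<and> agree (Suc p) B1 G H e e' \<Longrightarrow> sat G e \<phi> = sat H e' \<phi>"
      using PImp by auto
    obtain B2 where B2: "B2 \<ge> 1" "\<And>e e'. range e \<subseteq> pdom G \<and> e p = pone G \<and>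
        range e' \<subseteq> pdom H \<and> e' p = pone H \<and> agree (Suc p) B2 G H e e' \<Longrightarrow> sat G e \<psi> = sat H e' \<psi>"
      using PImp by auto
    show ?case
    proof (intro exI conjI allI impI)
      show "max B1 B2 \<ge> 1" using B1 by simp
      fix e e' assume *: "range e \<subseteq> pdom G \<and> e p = pone G \<and> range e' \<subseteq> pdom H \<and> e' p = pone H \<and>
        agree (Suc p) (max B1 B2) G H e e'"
      then have "agree (Suc p) B1 G H e e'" "agree (Suc p) B2 G H e e'"
        by (auto intro: agree_mono)
      then have "sat G e \<phi> = sat H e' \<phi>" "sat G e \<psi> = sat H e' \<psi>"
        using * by (auto intro!: B1(2) B2(2))
      then show "sat G e (PImp \<phi> \<psi>) = sat H e' (PImp \<phi> \<psi>)"
        by simp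
    qed
  next
    case (PAll j \<phi>)
    obtain B where B: "B \<ge> 1" "\<And>e e'. range e \<subseteq> pdom G \<and> e p = pone G \<and>
        range e' \<subseteq> pdom H \<and> e' p = pone H \<and> agree (Suc p) B G H e e' \<Longrightarrow> sat G e \<phi> = sat H e' \<phi>"
      using PAll by auto
    have "j < p"
      using PAll by simp
    show ?case
    proof (intro exI conjI allI impI)
      show "max 1 (extension_bound B) \<ge> 1" by simp
      fix e e' assume *: "range e \<subseteq> pdom G \<and> e p = pone G \<and> range e' \<subseteq> pdom H \<and> e' p = pone H \<and>
        agree (Suc p) (max 1 (extension_bound B)) G H e e'"
      then have ag: "agree (Suc p) (extension_bound B) G H e e'"
        by (auto intro: agree_mono)
      have upd: "sat G (e(j := a)) \<phi> = sat H (e'(j := a')) \<phi>"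
        if "a \<in> pdom G" "a' \<in> pdom H" "agree (Suc p) B G H (e(j := a)) (e'(j := a'))" for a a'
        using that * \<open>j < p\<close> by (intro B(2)) auto
      show "sat G e (PAll j \<phi>) = sat H e' (PAll j \<phi>)"
      proof
        assume all: "sat G e (PAll j \<phi>)"
        \<comment> \<open>Here the element to be matched lies in \<open>H\<close>; agreement is
          symmetric, so the extension step applies with the groups exchanged.\<close>
        have "sat H (e'(j := a')) \<phi>" if "a' \<in> pdom H" for a'
          using agree_extend [OF H G _ _ _ _ _ _ _ B(1) ag [unfolded agree_sym [of _ _ G]] that, of p j] * \<open>j < p\<close>
            upd that all by (auto simp: agree_sym [of _ _ H])
        then show "sat H e' (PAll j \<phi>)" by simp
      next
        assume all: "sat H e' (PAll j \<phi>)"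
        have "sat G (e(j := a)) \<phi>" if "a \<in> pdom G" for a
          using agree_extend [OF G H _ _ _ _ _ _ _ B(1) ag that, of p j] * \<open>j < p\<close> upd that all by auto
        then show "sat G e (PAll j \<phi>)" by simp
      qed
    qed
  }
qed

lemma term_val_cong: "(\<And>n. n \<in> term_vars t \<Longrightarrow> e n = e' n) \<Longrightarrow> term_val M e t = term_val M e' t"
  by (induction t) auto

lemma sat_cong: "(\<And>n. n \<in> free_vars \<phi> \<Longrightarrow> e n = e' n) \<Longrightarrow> sat M e \<phi> = sat M e' \<phi>"
proof (induction \<phi> arbitrary: e e')
  case (PEq s t)
  then show ?case using term_val_cong [of s e e'] term_val_cong [of t e e'] by auto
next
  case (PLe s t)
  then show ?case using term_val_cong [of s e e'] term_val_cong [of t e e'] by auto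
next
  case (PImp \<phi> \<psi>)
  then show ?case by (metis UnCI free_vars.simps(4) sat.simps(4))
next
  case (PAll n \<phi>)
  have "sat M (e(n := a)) \<phi> = sat M (e'(n := a)) \<phi>" for a
    by (rule PAll.IH) (use PAll.prems in auto)
  then show ?case by simp
qed simp

text \<open>For assignments that are 1 in slot \<open>p\<close> and 0 elsewhere, every form is an
  integer multiple of 1. Its sign and its divisibility are those of the integer, so two such
  assignments agree up to any bound.\<close>

theorem zgroup_elementarily_equivalent:
  assumes G: "zgroup G" and H: "zgroup H" and "sentence \<phi>" and models: "models H \<phi>"
  shows "models G \<phi>"
  unfolding models_def
proof (intro allI impI)
  interpret G: zgroup G by fact
  interpret H: zgroup H by fact
  fix e :: "nat \<Rightarrow> 'a" assume "range e \<subseteq> pdom G"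
  obtain p where "vars_below p \<phi>"
    using ex_vars_below by blast
  then obtain B where B: "\<And>e e'. range e \<subseteq> pdom G \<and> e p = pone G \<and>
      range e' \<subseteq> pdom H \<and> e' p = pone H \<and> agree (Suc p) B G H e e' \<Longrightarrow> sat G e \<phi> = sat H e' \<phi>"
    using ex_sat_agree [OF G H] by blast
  define g where "g = (\<lambda>i. if i = p then pone G else pzero G)"
  define h where "h = (\<lambda>i. if i = p then pone H else pzero H)"
  have g: "range g \<subseteq> pdom G" "g p = pone G" and h: "range h \<subseteq> pdom H" "h p = pone H"
    by (auto simp: g_def h_def)
  have "lin G (Suc p) c g = c p \<cdot>\<^bsub>G\<^esub> \<^bold>1\<^bsub>G\<^esub>" for c
    unfolding g_def by (rule G.lin_constant) simp
  moreover have "lin H (Suc p) c h = c p \<cdot>\<^bsub>H\<^esub> \<^bold>1\<^bsub>H\<^esub>" for c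
    unfolding h_def by (rule H.lin_constant) simp
  ultimately have "agree (Suc p) B G H g h"
    by (auto simp: agree_def G.pos_one_zmul H.pos_one_zmul G.ndvd_zmul_one H.ndvd_zmul_one simp del: lin.simps)
  then have "sat G g \<phi>"
    using B g h models by (auto simp: models_def)
  then show "sat G e \<phi>"
    using sat_cong [of \<phi> g e G] \<open>sentence \<phi>\<close> by (simp add: sentence_def)
qed

section \<open>The integers as group of comparison\<close>

lemma zmul_int_struct: "zmul int_struct k x = k * x"
proof -
  have "nmul int_struct n x = int n * x" for n
    by (induction n) (auto simp: int_struct_def algebra_simps)
  then show ?thesis
    by (simp add: zmul_def) (simp add: int_struct_def)
qed

lemma zgroup_int_struct: "zgroup int_struct"
proof
  fix n x :: int
  assume "n > 0"
  then show "\<exists>q\<in>pdom int_struct. \<exists>k. x = padd int_struct (zmul int_struct n q) (zmul int_struct k (pone int_struct))"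
    unfolding zmul_int_struct
    by (intro bexI [of _ "x div n"] exI [of _ "x mod n"]) (auto simp: int_struct_def)
qed (auto simp: int_struct_def pos_def is_structure_def)

lemma zgroup_presburger_model: "zgroup M \<Longrightarrow> presburger_model M"
  using zgroup_elementarily_equivalent [OF _ zgroup_int_struct]
    discrete_pgroup.is_struct [OF zgroup.axioms(1)]
  by (auto simp: presburger_model_def presburger_arithmetic_def)

section \<open>Unrolling a truncated group\<close>

context toag
begin

lemma refl [simp]: "x \<in> tcarrier T \<Longrightarrow> x \<sqsubseteq> x"
  using le_refl by (simp add: reflp_on_def)

lemma trans: "\<lbrakk>x \<in> tcarrier T; y \<in> tcarrier T; z \<in> tcarrier T; x \<sqsubseteq> y; y \<sqsubseteq> z\<rbrakk> \<Longrightarrow> x \<sqsubseteq> z"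
  using le_trans by (meson transp_onD)

lemma antisym: "\<lbrakk>x \<in> tcarrier T; y \<in> tcarrier T; x \<sqsubseteq> y; y \<sqsubseteq> x\<rbrakk> \<Longrightarrow> x = y"
  using le_antisym by (meson antisymp_onD)

lemma linear: "\<lbrakk>x \<in> tcarrier T; y \<in> tcarrier T\<rbrakk> \<Longrightarrow> x \<sqsubseteq> y \<or> y \<sqsubseteq> x"
  using le_total refl by (metis totalp_onD)

lemmas closed [simp, intro] = zero_closed top_closed add_closed

lemma less_top: "x \<in> tcarrier T \<Longrightarrow> x \<sqsubset> \<tau> \<longleftrightarrow> x \<noteq> \<tau>"
  by (simp add: tless_def top_greatest)

lemma zero_less: "x \<in> tcarrier T \<Longrightarrow> \<zero> \<sqsubset> x \<longleftrightarrow> x \<noteq> \<zero>"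
  by (auto simp: tless_def zero_least)

lemma add_zero_left [simp]: "x \<in> tcarrier T \<Longrightarrow> \<zero> \<oplus> x = x"
  by (simp add: ax1 [of \<zero>] ax2)

lemma top_add [simp]: "x \<in> tcarrier T \<Longrightarrow> \<tau> \<oplus> x = \<tau>"
  by (simp add: ax1 [of \<tau>] ax3)

lemma le_add_left: "\<lbrakk>x \<in> tcarrier T; y \<in> tcarrier T\<rbrakk> \<Longrightarrow> x \<sqsubseteq> x \<oplus> y"
  using ax4 [of x x \<zero> y] by (simp add: ax2 zero_least)

lemma le_add_right: "\<lbrakk>x \<in> tcarrier T; y \<in> tcarrier T\<rbrakk> \<Longrightarrow> y \<sqsubseteq> x \<oplus> y"
  using le_add_left [of y x] by (simp add: ax1)

lemma top_le: "\<lbrakk>x \<in> tcarrier T; \<tau> \<sqsubseteq> x\<rbrakk> \<Longrightarrow> x = \<tau>"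
  by (simp add: antisym top_greatest)

lemma diff:
  assumes "x \<in> tcarrier T" "y \<in> tcarrier T" "x \<sqsubseteq> y" "y \<noteq> \<tau>"
  shows "y \<ominus> x \<in> tcarrier T" "x \<oplus> (y \<ominus> x) = y"
  using theI' [OF ax7 [OF assms(1-3)]] assms by (simp_all add: tdiff_def less_top)

lemma diff_eq: "\<lbrakk>x \<in> tcarrier T; z \<in> tcarrier T; x \<oplus> z \<noteq> \<tau>\<rbrakk> \<Longrightarrow> (x \<oplus> z) \<ominus> x = z"
  using ax6 [of x "(x \<oplus> z) \<ominus> x" z] diff [of x "x \<oplus> z"] by (simp add: le_add_left less_top)

lemma compl:
  assumes "x \<in> tcarrier T"
  shows "\<tau> \<ominus> x \<in> tcarrier T" "x \<oplus> (\<tau> \<ominus> x) = \<tau>"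
    "\<And>w. \<lbrakk>w \<in> tcarrier T; x \<oplus> w = \<tau>\<rbrakk> \<Longrightarrow> \<tau> \<ominus> x \<sqsubseteq> w"
proof -
  have "\<exists>!z. z \<in> tcarrier T \<and> x \<oplus> z = \<tau> \<and> (\<forall>w\<in>tcarrier T. x \<oplus> w = \<tau> \<longrightarrow> z \<sqsubseteq> w)"
    using ax8 [OF assms] antisym by blast
  from theI' [OF this] show "\<tau> \<ominus> x \<in> tcarrier T" "x \<oplus> (\<tau> \<ominus> x) = \<tau>"
    "\<And>w. \<lbrakk>w \<in> tcarrier T; x \<oplus> w = \<tau>\<rbrakk> \<Longrightarrow> \<tau> \<ominus> x \<sqsubseteq> w"
    unfolding tdiff_def by auto
qed

lemma compl_top: "\<tau> \<ominus> \<tau> = \<zero>"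
  using compl [of \<tau>] antisym zero_least by auto

text \<open>Complementation is an involution that sends \<tau> to 0, so only 0 can have complement
  \<tau>.\<close>

lemma compl_neq_top: "\<lbrakk>x \<in> tcarrier T; x \<noteq> \<zero>\<rbrakk> \<Longrightarrow> \<tau> \<ominus> x \<noteq> \<tau>"
  by (metis ax9 compl_top)

text \<open>In the unrolled group \<open>y \<ominus> (\<tau> \<ominus> x)\<close> is \<open>x + y - \<tau>\<close>.\<close>

lemma carry:
  assumes "x \<in> tcarrier T" "y \<in> tcarrier T" "y \<noteq> \<tau>" "x \<oplus> y = \<tau>"
  shows "y \<ominus> (\<tau> \<ominus> x) \<in> tcarrier T" "(\<tau> \<ominus> x) \<oplus> (y \<ominus> (\<tau> \<ominus> x)) = y"
    "y \<ominus> (\<tau> \<ominus> x) \<sqsubseteq> y" "y \<ominus> (\<tau> \<ominus> x) \<noteq> \<tau>"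
proof -
  show *: "y \<ominus> (\<tau> \<ominus> x) \<in> tcarrier T" "(\<tau> \<ominus> x) \<oplus> (y \<ominus> (\<tau> \<ominus> x)) = y"
    using diff [of "\<tau> \<ominus> x" y] compl [OF assms(1)] assms by simp_all
  show "y \<ominus> (\<tau> \<ominus> x) \<sqsubseteq> y"
    using le_add_right [of "\<tau> \<ominus> x" "y \<ominus> (\<tau> \<ominus> x)"] * compl(1) [OF assms(1)] by simp
  then show "y \<ominus> (\<tau> \<ominus> x) \<noteq> \<tau>"
    using top_le assms(2,3) by metis
qed

lemma carry_comm:
  "\<lbrakk>x \<in> tcarrier T; y \<in> tcarrier T; x \<noteq> \<tau>; y \<noteq> \<tau>; x \<oplus> y = \<tau>\<rbrakk>
    \<Longrightarrow> y \<ominus> (\<tau> \<ominus> x) = x \<ominus> (\<tau> \<ominus> y)"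
  by (rule ax10) (simp_all add: less_top)

text \<open>Adding \<open>\<tau> - z\<close> to the two carries gives back \<open>x\<close> and
  \<open>y\<close>, so a reversed order of the carries would force \<open>x = y\<close>.\<close>

lemma carry_mono:
  assumes x: "x \<in> tcarrier T" "x \<noteq> \<tau>" and y: "y \<in> tcarrier T" "y \<noteq> \<tau>"
    and z: "z \<in> tcarrier T" "z \<noteq> \<tau>" and "x \<sqsubseteq> y" "x \<oplus> z = \<tau>" "y \<oplus> z = \<tau>"
  shows "z \<ominus> (\<tau> \<ominus> x) \<sqsubseteq> z \<ominus> (\<tau> \<ominus> y)"
proof -
  let ?p = "z \<ominus> (\<tau> \<ominus> x)" and ?q = "z \<ominus> (\<tau> \<ominus> y)"
  have p: "?p \<in> tcarrier T" "(\<tau> \<ominus> z) \<oplus> ?p = x"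
    using carry [of z x] carry_comm [of x z] assms by (simp_all add: ax1 [of z])
  have q: "?q \<in> tcarrier T" "(\<tau> \<ominus> z) \<oplus> ?q = y"
    using carry [of z y] carry_comm [of y z] assms by (simp_all add: ax1 [of z])
  show ?thesis
  proof (rule ccontr)
    assume n: "\<not> ?p \<sqsubseteq> ?q"
    then have "?q \<sqsubseteq> ?p"
      using linear p q by blast
    then have "y \<sqsubseteq> x"
      using ax4 [of "\<tau> \<ominus> z" "\<tau> \<ominus> z" ?q ?p] p q compl(1) [OF z(1)] by simp
    then have "x = y"
      using antisym x y \<open>x \<sqsubseteq> y\<close> by blast
    then show False
      using n p by simp
  qed
qed

end

text \<open>\<open>(x, k)\<close> with x below the top stands for \<open>x + k\<tau>\<close>.\<close>

definition unrolling :: "'a trunc \<Rightarrow> 'a \<Rightarrow> ('a \<times> int) pstruct"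
  where "unrolling T u =
    \<lparr>pdom = {g. fst g \<in> tcarrier T \<and> fst g \<noteq> \<tau>\<^bsub>T\<^esub>},
     padd = (\<lambda>(x, k) (y, l). if x \<oplus>\<^bsub>T\<^esub> y = \<tau>\<^bsub>T\<^esub>
       then (y \<ominus>\<^bsub>T\<^esub> (\<tau>\<^bsub>T\<^esub> \<ominus>\<^bsub>T\<^esub> x), k + l + 1) else (x \<oplus>\<^bsub>T\<^esub> y, k + l)),
     pneg = (\<lambda>(x, k). if x = \<zero>\<^bsub>T\<^esub> then (\<zero>\<^bsub>T\<^esub>, - k) else (\<tau>\<^bsub>T\<^esub> \<ominus>\<^bsub>T\<^esub> x, - k - 1)),
     ple = (\<lambda>(x, k) (y, l). k < l \<or> k = l \<and> x \<sqsubseteq>\<^bsub>T\<^esub> y),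
     pzero = (\<zero>\<^bsub>T\<^esub>, 0),
     pone = (if u = \<tau>\<^bsub>T\<^esub> then (\<zero>\<^bsub>T\<^esub>, 1) else (u, 0))\<rparr>"

definition unroll :: "'a trunc \<Rightarrow> 'a \<Rightarrow> 'a \<times> int"
  where "unroll T x = (if x = \<tau>\<^bsub>T\<^esub> then (\<zero>\<^bsub>T\<^esub>, 1) else (x, 0))"

locale toag_one = toag +
  fixes u
  assumes least_positive: "least_positive T u"
begin

lemma u_in [simp]: "u \<in> tcarrier T"
  and u_neq_zero: "u \<noteq> \<zero>"
  and u_least: "\<lbrakk>x \<in> tcarrier T; x \<noteq> \<zero>\<rbrakk> \<Longrightarrow> u \<sqsubseteq> x"
  using least_positive zero_less by (auto simp: least_positive_def)

text \<open>A positive element excludes the one-point truncation, for which no pair would be allowed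
  in the unrolling.\<close>

lemma zero_neq_top: "\<zero> \<noteq> \<tau>"
  using u_neq_zero top_le u_in zero_least antisym by (metis closed(1) top_greatest)

abbreviation M where "M \<equiv> unrolling T u"

lemma in_M: "(x, k) \<in> pdom (unrolling T v) \<longleftrightarrow> x \<in> tcarrier T \<and> x \<noteq> \<tau>"
  by (simp add: unrolling_def)

lemma add_M: "padd (unrolling T v) (x, k) (y, l) =
    (if x \<oplus> y = \<tau> then (y \<ominus> (\<tau> \<ominus> x), k + l + 1) else (x \<oplus> y, k + l))"
  and neg_M: "pneg (unrolling T v) (x, k) = (if x = \<zero> then (\<zero>, - k) else (\<tau> \<ominus> x, - k - 1))"
  and le_M: "ple (unrolling T v) (x, k) (y, l) \<longleftrightarrow> k < l \<or> k = l \<and> x \<sqsubseteq> y"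
  and zero_M: "pzero (unrolling T v) = (\<zero>, 0)"
  and one_M: "pone (unrolling T v) = unroll T v"
  by (simp_all add: unrolling_def unroll_def)

section \<open>The group laws of the unrolling\<close>

lemma add_M_comm: "\<lbrakk>g \<in> pdom M; h \<in> pdom M\<rbrakk> \<Longrightarrow> padd M g h = padd M h g"
  by (cases g; cases h) (auto simp: in_M add_M carry_comm ax1)

lemma add_M_in: "\<lbrakk>g \<in> pdom M; h \<in> pdom M\<rbrakk> \<Longrightarrow> padd M g h \<in> pdom M"
  by (cases g; cases h) (auto simp: in_M add_M carry)

lemma neg_M_in: "g \<in> pdom M \<Longrightarrow> pneg M g \<in> pdom M"
  using zero_neq_top compl(1) compl_neq_top by (cases g) (auto simp: in_M neg_M)

lemma unroll_in: "x \<in> tcarrier T \<Longrightarrow> unroll T x \<in> pdom M"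
  using zero_neq_top by (simp add: unroll_def in_M)

text \<open>By \<open>ax13\<close> adding \<open>z\<close> to \<open>x + y - \<tau>\<close> does not
  overflow again, so both sides carry exactly once; \<open>ax12\<close> equates the first
  components.\<close>

lemma add_M_assoc_carry:
  assumes x: "x \<in> tcarrier T" "x \<noteq> \<tau>" and y: "y \<in> tcarrier T" "y \<noteq> \<tau>"
    and z: "z \<in> tcarrier T" "z \<noteq> \<tau>" and xy: "x \<oplus> y = \<tau>" and yz: "y \<oplus> z \<noteq> \<tau>"
  shows "padd M (padd M (x, k) (y, l)) (z, m) = padd M (x, k) (padd M (y, l) (z, m))"
proof -
  let ?w = "y \<ominus> (\<tau> \<ominus> x)"
  have w: "?w \<in> tcarrier T"
    using carry x y xy by blast
  have yx: "y \<oplus> x = \<tau>"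
    using xy ax1 x y by simp
  have zw: "z \<oplus> ?w \<noteq> \<tau>"
    using ax13 [of x y z] x y z yx yz w by (simp add: less_top)
  have xyz: "x \<oplus> (y \<oplus> z) = \<tau>"
    using ax5 [of x y z] x y z xy by simp
  have "z \<oplus> ?w = x \<ominus> (\<tau> \<ominus> (y \<oplus> z))"
    by (rule ax12) (use x y z xy yx yz zw w in \<open>simp_all add: less_top\<close>)
  also have "\<dots> = (y \<oplus> z) \<ominus> (\<tau> \<ominus> x)"
    using carry_comm [of x "y \<oplus> z"] x y z yz xyz by simp
  finally show ?thesis
    using xy yz zw xyz w z by (simp add: add_M ax1 [of z])
qed

text \<open>The cases record which inner sums overflow. \<open>ax11\<close> handles an overflow in
  the outer additions only, the preceding lemma a single inner overflow, and \<open>ax14\<close> and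
  \<open>ax16\<close> two inner overflows with one or two carries in total.\<close>

lemma add_M_assoc:
  assumes "g \<in> pdom M" "h \<in> pdom M" "i \<in> pdom M"
  shows "padd M (padd M g h) i = padd M g (padd M h i)"
proof -
  obtain x k y l z m where eq: "g = (x, k)" "h = (y, l)" "i = (z, m)"
    by (metis surj_pair)
  have x: "x \<in> tcarrier T" "x \<noteq> \<tau>" and y: "y \<in> tcarrier T" "y \<noteq> \<tau>" and z: "z \<in> tcarrier T" "z \<noteq> \<tau>"
    using assms by (simp_all add: eq in_M)
  consider "x \<oplus> y \<noteq> \<tau>" "y \<oplus> z \<noteq> \<tau>" | "x \<oplus> y = \<tau>" "y \<oplus> z \<noteq> \<tau>"
    | "x \<oplus> y \<noteq> \<tau>" "y \<oplus> z = \<tau>" | "x \<oplus> y = \<tau>" "y \<oplus> z = \<tau>"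
    by blast
  then show ?thesis
  proof cases
    case 1
    show ?thesis
    proof (cases "x \<oplus> (y \<oplus> z) = \<tau>")
      case True
      have "x \<ominus> (\<tau> \<ominus> (y \<oplus> z)) = z \<ominus> (\<tau> \<ominus> (x \<oplus> y))"
        by (rule ax11) (use x y z 1 True in \<open>simp_all add: less_top ax1 [of y x]\<close>)
      then show ?thesis
        using 1 True x y z carry_comm [of x "y \<oplus> z"] by (simp add: eq add_M flip: ax5)
    next
      case False
      then show ?thesis
        using 1 x y z by (simp add: eq add_M flip: ax5)
    qed
  next
    case 2
    then show ?thesis
      using add_M_assoc_carry x y z by (simp add: eq)
  next
    case 3
    \<comment> \<open>The mirror image of the second case, brought back by commutativity.\<close>
    then have "padd M (padd M i h) g = padd M i (padd M h g)"
      using add_M_assoc_carry [of z y x m l k] x y z by (simp add: eq ax1)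
    then show ?thesis
      using assms by (metis add_M_comm add_M_in)
  next
    case 4
    let ?w = "y \<ominus> (\<tau> \<ominus> x)" and ?v = "y \<ominus> (\<tau> \<ominus> z)"
    have yx: "y \<oplus> x = \<tau>" and zy: "z \<oplus> y = \<tau>"
      using 4 x y z by (simp_all add: ax1)
    have w: "?w \<in> tcarrier T" "?w \<noteq> \<tau>" and v: "?v \<in> tcarrier T" "?v \<noteq> \<tau>"
      using carry [of x y] carry [of z y] x y z 4 zy by auto
    have w': "x \<ominus> (\<tau> \<ominus> y) = ?w" and v': "z \<ominus> (\<tau> \<ominus> y) = ?v"
      using carry_comm [of x y] carry_comm [of y z] x y z 4 by simp_all
    show ?thesis
    proof (cases "z \<oplus> ?w = \<tau>")
      case False
      have "x \<oplus> ?v = ?w \<oplus> z"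
        using ax14 [of x y z] x y z yx 4 False w by (simp add: less_top w')
      then show ?thesis
        using 4 False w v' z by (simp add: eq add_M ax1 [of z])
    next
      case True
      have xv: "x \<oplus> ?v = \<tau>"
      \<comment> \<open>Otherwise \<open>ax14\<close> with \<open>x\<close> and \<open>z\<close>
        exchanged would equate \<open>z \<oplus> ?w\<close> with \<open>?v \<oplus> x\<close>, so
        the two sums overflow together.\<close>
      proof (rule ccontr)
        assume n: "x \<oplus> ?v \<noteq> \<tau>"
        then have "z \<oplus> ?w = ?v \<oplus> x"
          using ax14 [of z y x] x y z yx 4 v by (simp add: less_top v')
        then show False
          using n True x v by (simp add: ax1)
      qed
      have "?w \<ominus> (\<tau> \<ominus> z) = ?v \<ominus> (\<tau> \<ominus> x)"
        using ax16 [of x y z] x y z yx 4 xv by simp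
      then have "z \<ominus> (\<tau> \<ominus> ?w) = ?v \<ominus> (\<tau> \<ominus> x)"
        using carry_comm [of ?w z] w z True by (simp add: ax1)
      then show ?thesis
        using 4 True xv v' w z by (simp add: eq add_M ax1 [of ?w])
    qed
  qed
qed

lemma add_M_mono:
  assumes "g \<in> pdom M" "h \<in> pdom M" "i \<in> pdom M" "ple M g h"
  shows "ple M (padd M g i) (padd M h i)"
proof -
  obtain x k y l z m where eq: "g = (x, k)" "h = (y, l)" "i = (z, m)"
    by (metis surj_pair)
  have x: "x \<in> tcarrier T" "x \<noteq> \<tau>" and y: "y \<in> tcarrier T" "y \<noteq> \<tau>" and z: "z \<in> tcarrier T" "z \<noteq> \<tau>"
    using assms by (simp_all add: eq in_M)
  from assms(4) consider "k < l" | "k = l" "x \<sqsubseteq> y"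
    by (auto simp: eq le_M)
  then show ?thesis
  proof cases
    case 1
    \<comment> \<open>A carry on the smaller side may close the gap between \<open>k\<close> and
      \<open>l\<close>, but then its first component has dropped to at most
      \<open>z\<close>.\<close>
    have "z \<ominus> (\<tau> \<ominus> x) \<sqsubseteq> y \<oplus> z" if "x \<oplus> z = \<tau>"
      using carry [of x z] le_add_right [of y z] trans [of _ z "y \<oplus> z"] that x y z by blast
    with 1 show ?thesis
      by (auto simp: eq add_M le_M)
  next
    case 2
    then have "x \<oplus> z \<sqsubseteq> y \<oplus> z"
      using ax4 x y z by simp
    then show ?thesis
      using 2 carry_mono [OF x y z 2(2)] top_le [of "y \<oplus> z"] y z by (auto simp: eq add_M le_M)
  qed
qed

lemma discrete_pgroup_M: "discrete_pgroup M"
proof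
  show "is_structure M"
    using zero_neq_top unroll_in
    by (simp add: is_structure_def add_M_in neg_M_in zero_M one_M in_M)
next
  fix g assume "g \<in> pdom M"
  then show "padd M g (pzero M) = g"
    by (cases g) (auto simp: in_M add_M zero_M ax2)
next
  fix g assume "g \<in> pdom M"
  then show "padd M g (pneg M g) = pzero M"
    using zero_neq_top compl diff_eq [of _ \<zero>] compl_neq_top
    by (cases g) (auto simp: in_M add_M neg_M zero_M ax2)
next
  fix g h assume "g \<in> pdom M" "h \<in> pdom M" "ple M g h" "ple M h g"
  then show "g = h"
    by (cases g; cases h) (auto simp: in_M le_M intro: antisym)
next
  fix g h i assume "g \<in> pdom M" "h \<in> pdom M" "i \<in> pdom M" "ple M g h" "ple M h i"
  then show "ple M g i"
    using trans [of "fst g" "fst h" "fst i"] by (cases g; cases h; cases i) (auto simp: in_M le_M)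
next
  fix g h assume "g \<in> pdom M" "h \<in> pdom M"
  then show "ple M g h \<or> ple M h g"
    using linear [of "fst g" "fst h"] by (cases g; cases h) (auto simp: in_M le_M)
next
  show "pos M (pone M)"
    using u_neq_zero by (auto simp: pos_def one_M zero_M unroll_def le_M zero_least)
next
  fix g assume "g \<in> pdom M" "pos M g"
  then show "ple M (pone M) g"
    using u_least [of "fst g"] top_le [of "fst g"]
    by (cases g) (auto simp: pos_def one_M zero_M unroll_def le_M in_M zero_least)
qed (simp_all add: add_M_assoc add_M_comm add_M_mono)

sublocale M: discrete_pgroup M
  by (rule discrete_pgroup_M)

section \<open>Transfer between the truncation and the unrolling\<close>

lemma unroll_add:
  "\<lbrakk>x \<in> tcarrier T; y \<in> tcarrier T; x \<oplus> y \<noteq> \<tau>\<rbrakk> \<Longrightarrow> unroll T (x \<oplus> y) = padd M (unroll T x) (unroll T y)"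
  by (auto simp: unroll_def add_M ax3)

lemma tmult_in [simp]: "y \<in> tcarrier T \<Longrightarrow> tmult T n y \<in> tcarrier T"
  by (induction n) auto

text \<open>As \<tau> absorbs every summand, a multiple below \<tau> has all its partial sums below
  \<tau>, and there both additions coincide.\<close>

lemma unroll_tmult:
  "\<lbrakk>y \<in> tcarrier T; tmult T n y \<noteq> \<tau>\<rbrakk> \<Longrightarrow> unroll T (tmult T n y) = zmul M (int n) (unroll T y)"
proof (induction n)
  case 0
  then show ?case by (simp add: unroll_def zero_M)
next
  case (Suc n)
  then have "tmult T n y \<noteq> \<tau>" by auto
  with Suc show ?case
    using M.zmul_Suc [OF unroll_in, of y "int n"] by (simp add: unroll_add add.commute)
qed

text \<open>If \<open>u \<noteq> \<tau>\<close>, adding \<open>u\<close> to its complement overflows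
  with carry \<open>u - u = 0\<close>, by \<open>ax9\<close>. If \<open>u = \<tau>\<close>, the
  complement is 0 and 1 is already the pair (0, 1).\<close>

lemma top_eq: "(\<zero>, 1) = padd M (unroll T (\<tau> \<ominus> u)) (pone M)"
proof (cases "u = \<tau>")
  case True
  then show ?thesis
    using zero_neq_top by (simp add: compl_top unroll_def one_M add_M ax2)
next
  case False
  then show ?thesis
    using compl [of u] compl_neq_top [of u] u_neq_zero diff_eq [of u \<zero>] carry_comm [of u "\<tau> \<ominus> u"]
    by (simp add: unroll_def one_M add_M ax1 [of "\<tau> \<ominus> u"] ax9 ax2)
qed

lemma zmul_top: "zmul M k (\<zero>, 1) = (\<zero>, k)"
proof (induction k rule: int_induct [where k = 0])
  case base
  then show ?case by (simp add: zero_M)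
next
  case (step1 i)
  then show ?case
    using zero_neq_top by (simp add: M.zmul_Suc in_M add_M ax2)
next
  case (step2 i)
  then show ?case
    using zero_neq_top by (simp add: M.zmul_pred in_M add_M neg_M ax2)
qed

text \<open>The divisible elements \<open>n q + k\<close> form a subgroup \<open>R\<close>. It
  contains all elements below \<tau>, hence also \<tau> as the sum of its predecessor and 1, and
  these generate the unrolling.\<close>

lemma zgroup_M:
  assumes division: "\<And>n x. \<lbrakk>n \<ge> 1; x \<in> tcarrier T\<rbrakk> \<Longrightarrow>
    \<exists>y\<in>tcarrier T. \<exists>m<n. x = tmult T n y \<oplus> tmult T m u"
  shows "zgroup M"
proof
  fix n :: int and g assume "n > 0" and g: "g \<in> pdom M"
  define R where "R = {g. \<exists>q\<in>pdom M. \<exists>k. g = padd M (zmul M n q) (zmul M k (pone M))}"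
  have R_add: "padd M g h \<in> R" if gh: "g \<in> R" "h \<in> R" for g h
  proof -
    obtain q k q' k' where q: "q \<in> pdom M" "q' \<in> pdom M"
      and "g = padd M (zmul M n q) (zmul M k (pone M))" "h = padd M (zmul M n q') (zmul M k' (pone M))"
      using gh unfolding R_def by blast
    then have "padd M g h = padd M (zmul M n (padd M q q')) (zmul M (k + k') (pone M))"
      by (simp add: M.zmul_distrib M.zmul_add M.p_ac)
    then show ?thesis
      using q unfolding R_def by blast
  qed
  have R_zmul: "zmul M l g \<in> R" if g: "g \<in> R" for g l
  proof -
    obtain q k where q: "q \<in> pdom M" and "g = padd M (zmul M n q) (zmul M k (pone M))"
      using g unfolding R_def by blast
    then have "zmul M l g = padd M (zmul M n (zmul M l q)) (zmul M (l * k) (pone M))"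
      by (simp add: M.zmul_distrib mult.commute flip: M.zmul_mult)
    then show ?thesis
      using q unfolding R_def by blast
  qed
  have "pone M = padd M (zmul M n (pzero M)) (zmul M 1 (pone M))"
    by simp
  then have R_one: "pone M \<in> R"
    unfolding R_def by blast
  have R_unroll: "unroll T x \<in> R" if x: "x \<in> tcarrier T" "x \<noteq> \<tau>" for x
  proof -
    have "nat n \<ge> 1"
      using \<open>n > 0\<close> by simp
    then obtain y m where y: "y \<in> tcarrier T" and eq: "x = tmult T (nat n) y \<oplus> tmult T m u"
      using division x by blast
    \<comment> \<open>Since \<open>x\<close> is below \<tau>, neither summand is \<tau>, and the
      truncated equation is exact in the group.\<close>
    have "tmult T (nat n) y \<noteq> \<tau>" "tmult T m u \<noteq> \<tau>"
      using x y eq by (auto simp: ax3)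
    then have "unroll T x = padd M (zmul M n (unroll T y)) (zmul M (int m) (pone M))"
      using x y eq \<open>n > 0\<close> by (simp add: unroll_add unroll_tmult one_M)
    then show ?thesis
      using unroll_in [OF y] unfolding R_def by blast
  qed
  have R_top: "(\<zero>, 1) \<in> R"
    unfolding top_eq using compl [of u] compl_neq_top [of u] u_neq_zero
    by (intro R_add R_one R_unroll) auto
  obtain x k where xk: "g = (x, k)" "x \<in> tcarrier T" "x \<noteq> \<tau>"
    using g by (cases g) (auto simp: in_M)
  have "g = padd M (unroll T x) (zmul M k (\<zero>, 1))"
    using xk by (simp add: zmul_top unroll_def add_M ax2)
  then have "g \<in> R"
    using R_add R_unroll R_zmul R_top xk by metis
  then show "\<exists>q\<in>pdom M. \<exists>k. g = padd M (zmul M n q) (zmul M k (pone M))"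
    by (simp add: R_def)
qed

lemma trunc_iso_unroll: "trunc_iso T u (truncation M (\<zero>, 1)) (pone M) (unroll T)"
  unfolding trunc_iso_def
proof (intro conjI ballI)
  show "bij_betw (unroll T) (tcarrier T) (tcarrier (truncation M (\<zero>, 1)))"
    unfolding bij_betw_def
  proof
    show "inj_on (unroll T) (tcarrier T)"
      by (auto simp: inj_on_def unroll_def split: if_splits)
    have "g \<in> unroll T ` tcarrier T" if g: "g \<in> pdom M" "ple M (pzero M) g" "ple M g (\<zero>, 1)" for g
    proof -
      obtain x k where eq: "g = (x, k)" by (cases g)
      have x: "x \<in> tcarrier T" "x \<noteq> \<tau>" and k: "0 \<le> k" "k < 1 \<or> k = 1 \<and> x \<sqsubseteq> \<zero>"
        using g by (auto simp: eq in_M le_M zero_M)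
      then have "g = unroll T x \<or> g = unroll T \<tau>"
        using antisym zero_least by (auto simp: eq unroll_def)
      then show ?thesis
        using x by auto
    qed
    moreover have "unroll T x \<in> pdom M \<and> ple M (pzero M) (unroll T x) \<and> ple M (unroll T x) (\<zero>, 1)"
      if "x \<in> tcarrier T" for x
      using that unroll_in by (auto simp: unroll_def le_M zero_M zero_least)
    ultimately show "unroll T ` tcarrier T = tcarrier (truncation M (\<zero>, 1))"
      by (auto simp: truncation_def)
  qed
next
  fix x y assume xy: "x \<in> tcarrier T" "y \<in> tcarrier T"
  then show "(x \<sqsubseteq> y) \<longleftrightarrow> (unroll T x \<sqsubseteq>\<^bsub>truncation M (\<zero>, 1)\<^esub> unroll T y)"
    using top_le by (auto simp: truncation_def unroll_def le_M top_greatest)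
next
  fix x y assume xy: "x \<in> tcarrier T" "y \<in> tcarrier T"
  have eq: "unroll T x \<oplus>\<^bsub>truncation M (\<zero>, 1)\<^esub> unroll T y =
      (if ple M (padd M (unroll T x) (unroll T y)) (\<zero>, 1) then padd M (unroll T x) (unroll T y) else (\<zero>, 1))"
    by (simp add: truncation_def)
  show "unroll T (x \<oplus> y) = unroll T x \<oplus>\<^bsub>truncation M (\<zero>, 1)\<^esub> unroll T y"
  proof (cases "x \<oplus> y = \<tau>")
    case True
    \<comment> \<open>An overflowing sum is at least (0, 1) in the group, so the truncation leaves
      it unchanged only if it equals (0, 1).\<close>
    have "padd M (unroll T x) (unroll T y) = (\<zero>, 1)" if "ple M (padd M (unroll T x) (unroll T y)) (\<zero>, 1)"
      using that xy True zero_neq_top carry [of x y] antisym [of "y \<ominus> (\<tau> \<ominus> x)" \<zero>]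
        antisym [of x \<zero>] antisym [of y \<zero>]
      by (auto simp: unroll_def add_M le_M zero_least ax2 split: if_splits)
    moreover have "unroll T \<tau> = (\<zero>, 1)"
      by (simp add: unroll_def)
    ultimately show ?thesis
      unfolding eq True by metis
  next
    case False
    then have "padd M (unroll T x) (unroll T y) = (x \<oplus> y, 0)"
      using xy by (auto simp: unroll_def add_M ax3)
    then show ?thesis
      using False by (simp add: eq le_M) (simp add: unroll_def)
  qed
next
  show "unroll T u = pone M"
    by (simp add: one_M)
qed

lemma presburger_toag_if_division:
  assumes "\<And>n x. \<lbrakk>n \<ge> 1; x \<in> tcarrier T\<rbrakk> \<Longrightarrow>
    \<exists>y\<in>tcarrier T. \<exists>m<n. x = tmult T n y \<oplus> tmult T m u"
  shows "presburger_toag TYPE('a \<times> int) T u"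
proof -
  have "presburger_model M"
    by (rule zgroup_presburger_model [OF zgroup_M [OF assms]])
  moreover have "(\<zero>, 1) \<in> pdom M" "ple M (pzero M) (\<zero>, 1)"
    using zero_neq_top by (simp_all add: in_M zero_M le_M)
  ultimately show ?thesis
    unfolding presburger_toag_def
    using toag_axioms least_positive trunc_iso_unroll by blast
qed

section \<open>Successors and predecessors in the truncation\<close>

lemma successor_add_u:
  assumes "x \<in> tcarrier T" "x \<noteq> \<tau>"
  shows "successor_of T x (x \<oplus> u)"
proof -
  have "x \<noteq> x \<oplus> u"
    using ax6 [of x u \<zero>] assms u_neq_zero by (auto simp: ax2 less_top)
  moreover have "\<not> z \<sqsubset> x \<oplus> u" if z: "z \<in> tcarrier T" "x \<sqsubset> z" for z
  proof -
    \<comment> \<open>Every element above \<open>x\<close> is \<open>x\<close> plus some nonzero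
      \<open>w\<close>, and \<open>w\<close> is at least \<open>u\<close>; for
      \<open>z = \<tau>\<close> the complement of \<open>x\<close> serves as
      \<open>w\<close>.\<close>
    have "\<exists>w\<in>tcarrier T. x \<oplus> w = z"
      using compl [of x] diff [of x z] assms z by (cases "z = \<tau>") (auto simp: tless_def)
    then obtain w where w: "w \<in> tcarrier T" "x \<oplus> w = z" by blast
    then have "w \<noteq> \<zero>"
      using z assms by (auto simp: tless_def ax2)
    then have "x \<oplus> u \<sqsubseteq> z"
      using ax4 [of x x u w] u_least w assms by auto
    then show ?thesis
      using antisym [of z "x \<oplus> u"] z assms by (auto simp: tless_def)
  qed
  ultimately show ?thesis
    using assms le_add_left [of x u] by (auto simp: successor_of_def tless_def)
qed

text \<open>The predecessor is \<open>x - u\<close>. It must be below \<tau> for adding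
  \<open>u\<close> to be a proper step; at \<open>x = \<tau>\<close> this holds because
  \<open>u \<noteq> \<zero>\<close> has a complement below \<tau>.\<close>

lemma ex_predecessor:
  assumes "x \<in> tcarrier T" "x \<noteq> \<zero>"
  shows "\<exists>y. successor_of T y x"
proof -
  have "\<exists>y\<in>tcarrier T. u \<oplus> y = x \<and> y \<noteq> \<tau>"
  proof (cases "x = \<tau>")
    case True
    then show ?thesis
      using compl [of u] compl_neq_top [of u] u_neq_zero by auto
  next
    case False
    then show ?thesis
      using diff [of u x] assms u_least by (metis ax3 u_in)
  qed
  then show ?thesis
    using successor_add_u ax1 u_in by metis
qed

lemma discretely_ordered: "discretely_ordered T"
  unfolding discretely_ordered_def
  using successor_add_u ex_predecessor top_le zero_least antisym by (metis closed(1) tless_def)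

end

section \<open>Truncations of Presburger models\<close>

lemma presburger_model_sat:
  assumes "presburger_model M" "sentence \<phi>" "\<And>e. sat int_struct e \<phi>"
  shows "sat M (\<lambda>_. pzero M) \<phi>"
proof -
  have "\<phi> \<in> presburger_arithmetic"
    using assms by (simp add: presburger_arithmetic_def models_def)
  then show ?thesis
    using assms(1) by (auto simp: presburger_model_def models_def is_structure_def)
qed

section \<open>Division with remainder as a sentence\<close>

abbreviation PNot :: "pform \<Rightarrow> pform"
  where "PNot \<phi> \<equiv> PImp \<phi> PFalse"

primrec multiple_term :: "nat \<Rightarrow> pterm \<Rightarrow> pterm"
  where
    "multiple_term 0 t = PZero"
  | "multiple_term (Suc n) t = PAdd (multiple_term n t) t"

lemma term_val_multiple: "term_val M e (multiple_term n t) = nmul M n (term_val M e t)"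
  by (induction n) simp_all

lemma term_vars_multiple: "term_vars (multiple_term n t) \<subseteq> term_vars t"
  by (induction n) auto

text \<open>The language has only implication and falsity, so
  \<open>\<not> (A \<longrightarrow> B)\<close> encodes "A and not B", and recursion builds the
  conjunction over all remainders. Multiples exist only as iterated sums, hence one formula for each
  \<open>n\<close>.\<close>

primrec no_remainder :: "nat \<Rightarrow> nat \<Rightarrow> pform"
  where
    "no_remainder n 0 = PNot PFalse"
  | "no_remainder n (Suc k) =
      PNot (PImp (no_remainder n k)
        (PEq (PVar 0) (PAdd (multiple_term n (PVar 1)) (multiple_term k POne))))"

lemma sat_no_remainder:
  "sat M e (no_remainder n k) \<longleftrightarrow> (\<forall>m<k. e 0 \<noteq> padd M (nmul M n (e 1)) (nmul M m (pone M)))"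
  by (induction k) (auto simp: term_val_multiple less_Suc_eq)

lemma free_vars_no_remainder: "free_vars (no_remainder n k) \<subseteq> {0, 1}"
  using term_vars_multiple [of _ "PVar 1"] term_vars_multiple [of _ POne] by (induction k) fastforce+

text \<open>The quotient is required to be nonnegative, since it has to lie in the
  truncation.\<close>

definition division_sentence :: "nat \<Rightarrow> pform"
  where "division_sentence n = PAll 0 (PImp (PLe PZero (PVar 0))
    (PNot (PAll 1 (PImp (PLe PZero (PVar 1)) (no_remainder n n)))))"

lemma nmul_int_struct: "nmul int_struct n x = int n * x"
  using zmul_int_struct [of "int n" x] by (simp add: zmul_def)

lemma presburger_division:
  assumes M: "presburger_model M" and "n \<ge> 1" "x \<in> pdom M" "ple M (pzero M) x"
  shows "\<exists>y\<in>pdom M. ple M (pzero M) y \<and> (\<exists>m<n. x = padd M (nmul M n y) (nmul M m (pone M)))"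
proof -
  have "sentence (division_sentence n)"
    using free_vars_no_remainder by (auto simp: sentence_def division_sentence_def)
  moreover have "\<exists>y\<ge>0. \<exists>m<n. x = int n * y + int m" if "x \<ge> 0" for x
    using that \<open>n \<ge> 1\<close>
    by (intro exI [of _ "x div int n"] exI [of _ "nat (x mod int n)"] conjI)
      (auto simp: pos_imp_zdiv_nonneg_iff nat_less_iff)
  then have "sat int_struct e (division_sentence n)" for e
    by (simp add: division_sentence_def sat_no_remainder nmul_int_struct) (simp add: int_struct_def)
  ultimately have "sat M (\<lambda>_. pzero M) (division_sentence n)"
    by (rule presburger_model_sat [OF M])
  then show ?thesis
    using assms by (auto simp: division_sentence_def sat_no_remainder)
qed

section \<open>Order properties of Presburger models\<close>

context
  fixes M :: "'m pstruct"
  assumes M: "presburger_model M"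
begin

lemma presburger_refl: "a \<in> pdom M \<Longrightarrow> ple M a a"
  using presburger_model_sat [OF M, of "PAll 0 (PLe (PVar 0) (PVar 0))"]
  by (simp add: sentence_def int_struct_def insert_Diff_if)

lemma presburger_trans:
  assumes "a \<in> pdom M" "b \<in> pdom M" "c \<in> pdom M" "ple M a b" "ple M b c"
  shows "ple M a c"
proof -
  let ?\<phi> = "PImp (PLe (PVar 0) (PVar 1)) (PImp (PLe (PVar 1) (PVar 2)) (PLe (PVar 0) (PVar 2)))"
  have "sat M (\<lambda>_. pzero M) (PAll 0 (PAll 1 (PAll 2 ?\<phi>)))"
    by (rule presburger_model_sat [OF M]) (auto simp: sentence_def int_struct_def)
  then have "sat M ((\<lambda>_. pzero M)(0 := a, 1 := b, 2 := c)) ?\<phi>"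
    using assms unfolding sat.simps(5) by blast
  then show ?thesis
    using assms by simp
qed

lemma presburger_le_add: "\<lbrakk>a \<in> pdom M; b \<in> pdom M; ple M (pzero M) b\<rbrakk> \<Longrightarrow> ple M a (padd M a b)"
  using presburger_model_sat [OF M, of "PAll 0 (PAll 1 (PImp (PLe PZero (PVar 1))
    (PLe (PVar 0) (PAdd (PVar 0) (PVar 1)))))"]
  by (simp add: sentence_def int_struct_def insert_Diff_if)

lemma presburger_le_add': "\<lbrakk>a \<in> pdom M; b \<in> pdom M; ple M (pzero M) b\<rbrakk> \<Longrightarrow> ple M a (padd M b a)"
  using presburger_model_sat [OF M, of "PAll 0 (PAll 1 (PImp (PLe PZero (PVar 1))
    (PLe (PVar 0) (PAdd (PVar 1) (PVar 0)))))"]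
  by (simp add: sentence_def int_struct_def insert_Diff_if)

lemma presburger_zero_le_one: "ple M (pzero M) (pone M)"
  using presburger_model_sat [OF M, of "PLe PZero POne"] by (simp add: sentence_def int_struct_def insert_Diff_if)

end

text \<open>Multiples of a nonnegative element increase, so if the last one is at most
  \<open>t\<close>, none of the partial sums is cut off.\<close>

lemma tmult_truncation:
  assumes M: "presburger_model M" and "t \<in> pdom M" and y: "y \<in> pdom M" "ple M (pzero M) y"
    and "ple M (nmul M n y) t"
  shows "tmult (truncation M t) n y = nmul M n y"
proof -
  have M': "is_structure M"
    using M by (simp add: presburger_model_def)
  have closed: "nmul M k y \<in> pdom M" for k
    using M' y by (induction k) (auto simp: is_structure_def)
  show ?thesis
    using assms(5)
  proof (induction n)
    case 0
    then show ?case by (simp add: truncation_def)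
  next
    case (Suc n)
    have "ple M (nmul M n y) (nmul M (Suc n) y)"
      using presburger_le_add [OF M] closed y by simp
    then have "ple M (nmul M n y) t"
      using presburger_trans [OF M] closed Suc.prems \<open>t \<in> pdom M\<close> by blast
    with Suc show ?case
      by (simp add: truncation_def)
  qed
qed

text \<open>Divide \<open>f x\<close> in the model with a nonnegative quotient: \<open>y\<close>,
  \<open>n y\<close> and \<open>m\<close> are all at most \<open>f x\<close>, hence within the
  truncation, and nothing is cut off. This includes \<open>x = \<tau>\<close>.\<close>

lemma division_if_presburger_toag:
  fixes T :: "'a trunc"
  assumes "presburger_toag TYPE('m) T u" "n \<ge> 1" "x \<in> tcarrier T"
  shows "\<exists>y\<in>tcarrier T. \<exists>m<n. x = tmult T n y \<oplus>\<^bsub>T\<^esub> tmult T m u"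
proof -
  obtain M :: "'m pstruct" and t f where M: "presburger_model M" and t: "t \<in> pdom M" "ple M (pzero M) t"
    and iso: "trunc_iso T u (truncation M t) (pone M) f" and "toag T" and u: "least_positive T u"
    using assms(1) unfolding presburger_toag_def by blast
  interpret toag T by fact
  let ?N = "truncation M t"
  have M': "is_structure M"
    using M by (simp add: presburger_model_def)
  have carrier_N: "a \<in> tcarrier ?N \<longleftrightarrow> a \<in> pdom M \<and> ple M (pzero M) a \<and> ple M a t" for a
    by (simp add: truncation_def)
  have add_N: "a \<oplus>\<^bsub>?N\<^esub> b = (if ple M (padd M a b) t then padd M a b else t)" for a b
    by (simp add: truncation_def)
  have bij: "bij_betw f (tcarrier T) (tcarrier ?N)"
    and f_le: "\<And>a b. \<lbrakk>a \<in> tcarrier T; b \<in> tcarrier T\<rbrakk> \<Longrightarrow> a \<sqsubseteq>\<^bsub>T\<^esub> b \<longleftrightarrow> ple M (f a) (f b)"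
    and f_add: "\<And>a b. \<lbrakk>a \<in> tcarrier T; b \<in> tcarrier T\<rbrakk> \<Longrightarrow> f (a \<oplus>\<^bsub>T\<^esub> b) = f a \<oplus>\<^bsub>?N\<^esub> f b"
    and f_u: "f u = pone M"
    using iso by (auto simp: trunc_iso_def truncation_def)
  have f_in: "f a \<in> tcarrier ?N" if "a \<in> tcarrier T" for a
    using bij that by (auto simp: bij_betw_def)
  have u_in: "u \<in> tcarrier T"
    using u by (simp add: least_positive_def)
  have f_zero: "f \<zero>\<^bsub>T\<^esub> = pzero M"
  proof -
    \<comment> \<open>The isomorphism is not told about 0; its value there is recovered from the
      order.\<close>
    have "pzero M \<in> tcarrier ?N"
      using t M' presburger_refl [OF M] by (simp add: carrier_N is_structure_def)
    then obtain z where z: "z \<in> tcarrier T" "f z = pzero M"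
      using bij by (metis bij_betw_iff_bijections)
    have "z \<sqsubseteq>\<^bsub>T\<^esub> \<zero>\<^bsub>T\<^esub>"
      using f_in [of "\<zero>\<^bsub>T\<^esub>"] z by (simp add: f_le carrier_N)
    then show ?thesis
      using z zero_least [of z] antisym [of z "\<zero>\<^bsub>T\<^esub>"] by simp
  qed
  have tmult_in: "tmult T k y \<in> tcarrier T" if "y \<in> tcarrier T" for k y
    using that by (induction k) auto
  have f_tmult: "f (tmult T k y) = tmult ?N k (f y)" if "y \<in> tcarrier T" for k y
    using that by (induction k) (simp_all add: f_zero f_add tmult_in, simp add: truncation_def)
  have nmul_in: "nmul M k a \<in> pdom M" if "a \<in> pdom M" for k a
    using M' that by (induction k) (auto simp: is_structure_def)
  have nmul_nonneg: "ple M (pzero M) (nmul M k a)" if "a \<in> pdom M" "ple M (pzero M) a" for k a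
  proof (induction k)
    case 0
    show ?case
      using M' presburger_refl [OF M] by (simp add: is_structure_def)
  next
    case (Suc k)
    then show ?case
      using presburger_le_add [OF M nmul_in [OF that(1)] that] M' that nmul_in [OF that(1)]
        presburger_trans [OF M, of "pzero M" "nmul M k a"] by (simp add: is_structure_def)
  qed
  have fx: "f x \<in> pdom M" "ple M (pzero M) (f x)" "ple M (f x) t"
    using f_in [OF assms(3)] by (simp_all add: carrier_N)
  obtain y m where y: "y \<in> pdom M" "ple M (pzero M) y" and "m < n"
    and eq: "f x = padd M (nmul M n y) (nmul M m (pone M))"
    using presburger_division [OF M \<open>n \<ge> 1\<close> fx(1,2)] by blast
  have one: "pone M \<in> pdom M" "ple M (pzero M) (pone M)"
    using M' presburger_zero_le_one [OF M] by (simp_all add: is_structure_def)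
  have ny: "ple M (nmul M n y) t"
    using presburger_le_add [OF M nmul_in [OF y(1)] nmul_in [OF one(1)] nmul_nonneg [OF one]]
      presburger_trans [OF M] fx t nmul_in [OF y(1)] by (metis eq)
  have m1: "ple M (nmul M m (pone M)) t"
    using presburger_le_add' [OF M nmul_in [OF one(1)] nmul_in [OF y(1)] nmul_nonneg [OF y]]
      presburger_trans [OF M] fx t nmul_in [OF one(1)] by (metis eq)
  obtain n' where n': "n = Suc n'"
    using \<open>n \<ge> 1\<close> by (cases n) auto
  \<comment> \<open>Here \<open>n \<ge> 1\<close> matters: it puts \<open>y\<close> itself, and not
    only its multiple, below \<open>t\<close>.\<close>
  have "ple M y (nmul M n y)"
    using presburger_le_add' [OF M y(1) nmul_in [OF y(1)] nmul_nonneg [OF y]] by (simp add: n')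
  then have "ple M y t"
    using presburger_trans [OF M] ny y(1) nmul_in t(1) by blast
  then obtain z where z: "z \<in> tcarrier T" "f z = y"
    using y bij carrier_N [of y] by (metis bij_betw_iff_bijections)
  have "f (tmult T n z \<oplus>\<^bsub>T\<^esub> tmult T m u) = tmult ?N n y \<oplus>\<^bsub>?N\<^esub> tmult ?N m (pone M)"
    using z u_in by (simp add: f_add f_tmult tmult_in f_u)
  also have "\<dots> = f x"
    unfolding tmult_truncation [OF M t(1) y ny] tmult_truncation [OF M t(1) one m1]
    using fx by (simp add: add_N eq)
  finally have "tmult T n z \<oplus>\<^bsub>T\<^esub> tmult T m u = x"
    using bij assms(3) z u_in tmult_in by (auto simp: bij_betw_def inj_on_def)
  then show ?thesis
    using z \<open>m < n\<close> by blast
qed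

theorem theorem2:
  fixes T :: "'a trunc" and one :: 'a
  assumes "toag T"
    and "least_positive T one"
  shows "(presburger_toag TYPE('a \<times> int) T one \<longleftrightarrow>
            (discretely_ordered T \<and>
             (\<forall>x\<in>tcarrier T. \<zero>\<^bsub>T\<^esub> \<sqsubset>\<^bsub>T\<^esub> x \<longrightarrow> (\<exists>y. successor_of T y x))) \<and>
            (\<forall>n::nat. n \<ge> 1 \<longrightarrow> (\<forall>x\<in>tcarrier T. \<exists>y\<in>tcarrier T. \<exists>m<n.
               x = tmult T n y \<oplus>\<^bsub>T\<^esub> tmult T m one))) \<and>
         (presburger_toag TYPE('m) T one \<longrightarrow> presburger_toag TYPE('a \<times> int) T one)"
proof -
  interpret toag_one T one
    using assms by (simp add: toag_one_def toag_one_axioms_def)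
  have "\<exists>y. successor_of T y x" if "x \<in> tcarrier T" "\<zero>\<^bsub>T\<^esub> \<sqsubset>\<^bsub>T\<^esub> x" for x
    using that ex_predecessor zero_less by blast
  \<comment> \<open>Division is extracted twice: from a model over \<open>'a \<times> int\<close>
    for the equivalence, and from one over an arbitrary type for the change of type, where the
    unrolling then supplies the new model.\<close>
  then show ?thesis
    using discretely_ordered presburger_toag_if_division
      division_if_presburger_toag [where 'm = "'a \<times> int", of T one]
      division_if_presburger_toag [where 'm = 'm, of T one] by meson
qed

end
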